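(* Let $G$ be a $d$-regular locally countable Borel graph on a standard Borel space $X$, and let $\mu$ be a $G$-invariant Borel probability measure on $X$ such that $G$ is expansive with respect to $\mu$. Then $\o_\mu(G)=\lceil d/2\rceil$.
   Context: A graph $G$ on $X$ is a symmetric subset of $X^2$; $G_x=\{y:(x,y)\in G\}$. An orientation of $G$ is a relation $o\subseteq X^2$ such that $\{x,y\}\in G$ iff $(x,y)\in o$ or $(y,x)\in o$; $\operatorname{out}_o(x)=|o_x|$. $\mu$ is $G$-invariant if $G$ is a countable union of graphs of $\mu$-preserving Borel involutions. \[\o_\mu(G)=\min\Big\{\sup_{x\in A}\operatorname{out}_o(x): o \text{ a Borel orientation of } G\cap (A\times A),\ \mu(X\setminus A)=0\Big\}.\] The expansion constant is $\lambda_\mu(G)=\inf\{\frac{1}{\mu(A)}\int_{x\in A}|G_x\setminus A|\,d\mu: A \text{ Borel},\ 0<\mu(A)\le\frac12\}$, and $G$ is expansive if $\lambda_\mu(G)>0$.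
   Formalization: Graphs are required to have no loops, though the text says only "symmetric subset of X^2"; with loops the claim fails, e.g. for G = X^2 on 4 points with uniform measure (d = 4, orientation number 3). *)

theory Defs
  imports "HOL-Probability.Probability"
begin

text \<open>A second countable completely metrizable space is a Polish space.\<close>

definition standard_borel :: "'a measure \<Rightarrow> bool" where
  "standard_borel M \<longleftrightarrow>
     (\<exists>T. completely_metrizable_space T \<and> second_countable T \<and> topspace T = space M \<and>
          sets M = sigma_sets (topspace T) {U. openin T U})"

definition ecard :: "'a set \<Rightarrow> enat" where
  "ecard S = (if finite S then enat (card S) else \<infinity>)"

text \<open>Graphs are loopless. The neighbourhood of \<open>x\<close> is the relational image \<open>G `` {x}\<close>.\<close>

definition graph_on :: "'a set \<Rightarrow> ('a \<times> 'a) set \<Rightarrow> bool" where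
  "graph_on X G \<longleftrightarrow> G \<subseteq> X \<times> X \<and> sym G \<and> irrefl G"

definition borel_graph :: "'a measure \<Rightarrow> ('a \<times> 'a) set \<Rightarrow> bool" where
  "borel_graph M G \<longleftrightarrow> graph_on (space M) G \<and> G \<in> sets (M \<Otimes>\<^sub>M M)"

definition locally_countable :: "'a set \<Rightarrow> ('a \<times> 'a) set \<Rightarrow> bool" where
  "locally_countable X G \<longleftrightarrow> (\<forall>x\<in>X. countable (G `` {x}))"

definition regular :: "'a set \<Rightarrow> ('a \<times> 'a) set \<Rightarrow> nat \<Rightarrow> bool" where
  "regular X G d \<longleftrightarrow> (\<forall>x\<in>X. ecard (G `` {x}) = enat d)"

definition mp_involution :: "'a measure \<Rightarrow> ('a \<Rightarrow> 'a) \<Rightarrow> bool" where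
  "mp_involution M f \<longleftrightarrow>
     f \<in> M \<rightarrow>\<^sub>M M \<and> (\<forall>x\<in>space M. f (f x) = x) \<and> distr M M f = M"

text \<open>
  The loopless graph of an involution joins \<open>x\<close> to \<open>f x\<close> whenever \<open>f x \<noteq> x\<close>.  Allowing fixed
  points in this way amounts to allowing partial involutions defined on Borel sets; demanding
  fixed-point free involutions of the whole space would exclude, for instance, a triangle with
  the uniform measure.
\<close>

definition involution_graph :: "'a set \<Rightarrow> ('a \<Rightarrow> 'a) \<Rightarrow> ('a \<times> 'a) set" where
  "involution_graph X f = {(x, y). x \<in> X \<and> y = f x \<and> x \<noteq> y}"

definition invariant_measure :: "'a measure \<Rightarrow> ('a \<times> 'a) set \<Rightarrow> bool" where
  "invariant_measure M G \<longleftrightarrow>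
     (\<exists>f :: nat \<Rightarrow> 'a \<Rightarrow> 'a. (\<forall>n. mp_involution M (f n)) \<and>
        G = (\<Union>n. involution_graph (space M) (f n)))"

text \<open>An orientation may contain both directions of an edge.\<close>

definition orientation :: "('a \<times> 'a) set \<Rightarrow> ('a \<times> 'a) set \<Rightarrow> bool" where
  "orientation G r \<longleftrightarrow> (\<forall>x y. (x, y) \<in> G \<longleftrightarrow> (x, y) \<in> r \<or> (y, x) \<in> r)"

definition outdegree :: "('a \<times> 'a) set \<Rightarrow> 'a \<Rightarrow> enat" where
  "outdegree r x = ecard (r `` {x})"

definition orientation_values :: "'a measure \<Rightarrow> ('a \<times> 'a) set \<Rightarrow> enat set" where
  "orientation_values M G =
     {(SUP x\<in>A. outdegree r x) | A r.
        A \<in> sets M \<and> emeasure M (space M - A) = 0 \<and>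
        r \<in> sets (M \<Otimes>\<^sub>M M) \<and> orientation (G \<inter> A \<times> A) r}"

definition orientation_number :: "'a measure \<Rightarrow> ('a \<times> 'a) set \<Rightarrow> enat" where
  "orientation_number M G = Inf (orientation_values M G)"

text \<open>The infimum is a minimum.\<close>

lemma orientation_number_attained:
  assumes "borel_graph M G"
  shows "orientation_number M G \<in> orientation_values M G"
proof -
  have "G \<inter> space M \<times> space M = G"
    using assms by (auto simp: borel_graph_def graph_on_def)
  moreover have "orientation G G"
    using assms by (auto simp: borel_graph_def graph_on_def orientation_def dest: symD)
  ultimately have "(SUP x\<in>space M. outdegree G x) \<in> orientation_values M G"
    using assms unfolding orientation_values_def borel_graph_def
    by (intro CollectI exI[of _ "space M"] exI[of _ G]) auto
  then have "orientation_values M G \<noteq> {}"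
    by blast
  then show ?thesis
    unfolding orientation_number_def Inf_enat_def by (auto intro: LeastI)
qed

text \<open>
  The values lie in \<open>[0, \<infinity>]\<close>.  In the situation of interest \<open>x \<mapsto> |G\<^sub>x - A|\<close> is measurable by
  the Lusin--Novikov theorem.
\<close>

definition expansion_constant :: "'a measure \<Rightarrow> ('a \<times> 'a) set \<Rightarrow> ennreal" where
  "expansion_constant M G =
     (INF A\<in>{A \<in> sets M. 0 < emeasure M A \<and> emeasure M A \<le> 1 / 2}.
        (\<integral>\<^sup>+x\<in>A. ennreal_of_enat (ecard (G `` {x} - A)) \<partial>M) / emeasure M A)"

definition expansive :: "'a measure \<Rightarrow> ('a \<times> 'a) set \<Rightarrow> bool" where
  "expansive M G \<longleftrightarrow> 0 < expansion_constant M G"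

end

theory Submission
  imports Defs "HOL-Real_Asymp.Real_Asymp"
begin

text \<open>
  The lower bound is mass transport: out- and indegree have the same integral, and they add up to at
  least \<open>d\<close> almost everywhere. For the upper bound let \<open>k = \<lceil>d / 2\<rceil>\<close> and let the excess of an orientation
  be \<open>E = \<integral> (out - k)\<^sup>+\<close>. Start at the vertices of outdegree greater than \<open>k\<close> and follow the orientation:
  as long as no vertex of outdegree less than \<open>k\<close> is reached, at least half of the edge boundary of
  the reached set points outwards, so expansion makes this set grow exponentially and then its
  complement shrink exponentially. Hence if \<open>E > 0\<close> there is a path of length \<open>n = O(log (1 / E))\<close>
  from an overfull to an underfull vertex, for a set of starting points of positive measure \<open>t\<close>;
  thinning that set makes the paths disjoint, and reversing them lowers \<open>E\<close> by \<open>t\<close> at the cost of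
  reversing edges of measure at most \<open>2 n t = O(\<surd>E - \<surd>E')\<close>. As orientations form a complete space
  under the measure of the set of reversed edges, the Caristi (Brezis--Browder) principle yields an
  orientation which cannot be improved in this way, that is, with \<open>E = 0\<close>.
\<close>

section \<open>Preliminaries\<close>

text \<open>Greedy choice: let \<open>m\<close> be the infimum of \<open>F\<close> over the
  successors of \<open>x\<close>; some successor \<open>y\<close> gets at least halfway from
  \<open>F x\<close> down to \<open>m\<close>, so \<open>2 * F y - F x\<close> bounds
  \<open>F\<close> from below on all successors of \<open>x\<close>. Iterate this and let
  \<open>b\<close> bound the resulting chain; a successor \<open>c\<close> of \<open>b\<close> is a
  successor of every chain element, and in the limit \<open>F c\<close> is at least
  \<open>L\<close>, which is at least \<open>F b\<close>. Reflexivity is demanded only on the field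
  of \<open>R\<close>, so that \<open>R\<close> can also carry membership in a set.\<close>

lemma order_principle:
  fixes F :: "'b \<Rightarrow> real" and R :: "'b \<Rightarrow> 'b \<Rightarrow> bool"
  assumes nonneg: "\<And>x. 0 \<le> F x" and start: "R a a"
    and refl: "\<And>x y. R x y \<Longrightarrow> R y y" and trans: "\<And>x y z. R x y \<Longrightarrow> R y z \<Longrightarrow> R x z"
    and mono: "\<And>x y. R x y \<Longrightarrow> F y \<le> F x"
    and chain: "\<And>s :: nat \<Rightarrow> 'b. (\<And>n. R (s n) (s (Suc n))) \<Longrightarrow> \<exists>b. \<forall>n. R (s n) b"
  shows "\<exists>b. R a b \<and> (\<forall>c. R b c \<longrightarrow> F c = F b)"
proof -
  have "\<exists>y. R x y \<and> (\<forall>z. R x z \<longrightarrow> 2 * F y - F x \<le> F z)" if x: "R x x" for x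
  proof -
    define m where "m = Inf (F ` {y. R x y})"
    have bdd: "bdd_below (F ` {y. R x y})"
      using nonneg by (intro bdd_belowI[of _ 0]) auto
    have low: "m \<le> F z" if "R x z" for z
      unfolding m_def using that bdd by (intro cInf_lower) auto
    show ?thesis
    proof (cases "m < F x")
      case True
      then have "m < (F x + m) / 2" by simp
      moreover have "F ` {y. R x y} \<noteq> {}"
        using x by auto
      ultimately have "\<exists>v\<in>F ` {y. R x y}. v < (F x + m) / 2"
        using cInf_lessD[of "F ` {y. R x y}" "(F x + m) / 2"] by (auto simp: m_def)
      then obtain y where "R x y" "F y < (F x + m) / 2"
        by auto
      then show ?thesis
        using low by (intro exI[of _ y]) fastforce
    next
      case False
      then show ?thesis
        using low x by (intro exI[of _ x]) fastforce
    qed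
  qed
  then obtain g where g: "\<And>x. R x x \<Longrightarrow> R x (g x)"
    and gmin: "\<And>x z. R x x \<Longrightarrow> R x z \<Longrightarrow> 2 * F (g x) - F x \<le> F z"
    by metis
  define s where "s n = (g ^^ n) a" for n
  have ss: "R (s n) (s n)" for n
    by (induction n) (use start refl g in \<open>auto simp: s_def\<close>)
  have step: "R (s n) (s (Suc n))" for n
    using g[OF ss] by (simp add: s_def)
  obtain b where b: "\<And>n. R (s n) b"
    using chain[of s] step by auto
  have dec: "decseq (\<lambda>n. F (s n))"
    by (rule decseq_SucI) (use mono step in auto)
  obtain L where L: "(\<lambda>n. F (s n)) \<longlonglongrightarrow> L"
    using decseq_convergent[OF dec, of 0] nonneg by blast
  have Fb: "F b \<le> L"
    using L by (rule LIMSEQ_le_const) (use mono b in auto)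
  have "F c = F b" if c: "R b c" for c
  proof -
    have "2 * F (s (Suc n)) - F (s n) \<le> F c" for n
      using gmin[OF ss, of n c] trans[OF b c] by (simp add: s_def)
    moreover have "(\<lambda>n. 2 * F (s (Suc n)) - F (s n)) \<longlonglongrightarrow> 2 * L - L"
      using L LIMSEQ_Suc[OF L] by (intro tendsto_intros)
    ultimately have "2 * L - L \<le> F c"
      by (intro LIMSEQ_le_const2) auto
    then show ?thesis
      using Fb mono[OF c] by linarith
  qed
  then show ?thesis
    using b[of 0] by (auto simp: s_def)
qed

text \<open>\<open>n\<close> will be a path length and \<open>x\<close> an excess. The least
  admissible \<open>n\<close> is of order \<open>log (1 / x)\<close> for small \<open>x\<close>,
  which \<open>sqrt x\<close> outweighs. Minimality bounds \<open>(1 + c) ^ (n - 1) * x^2\<close> by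
  \<open>D\<close>, and the exponential dominates \<open>n ^ 4\<close>.\<close>

lemma logarithmic_exponent_bound:
  fixes c D :: real
  assumes c: "0 < c"
  shows "\<exists>K>0. \<forall>x>0. \<exists>n::nat. D < (1 + c) ^ n * x\<^sup>2 \<and> n * sqrt x \<le> K"
proof -
  \<comment> \<open>The exponent 4 is chosen because \<open>sqrt x ^ 4\<close> is the square of
    \<open>x\<close>, the quantity controlled by minimality of \<open>n\<close>.\<close>
  have "(\<lambda>m. real (Suc m) ^ 4 / (1 + c) ^ m) \<longlonglongrightarrow> 0"
    using c by real_asymp
  then have "Bseq (\<lambda>m. real (Suc m) ^ 4 / (1 + c) ^ m)"
    by (rule convergent_imp_Bseq[OF convergentI])
  then obtain C where C: "0 < C" "\<And>m. norm (real (Suc m) ^ 4 / (1 + c) ^ m) \<le> C"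
    by (auto elim: BseqE)
  have C': "real (Suc m) ^ 4 \<le> C * (1 + c) ^ m" for m
    using C(2)[of m] c by (simp add: field_simps)
  show ?thesis
  proof (intro exI[of _ "max 1 (C * D)"] conjI allI impI)
    fix x :: real assume x: "0 < x"
    obtain n0 where "D / x\<^sup>2 < (1 + c) ^ n0"
      using real_arch_pow[of "1 + c"] c by auto
    then have n0: "D < (1 + c) ^ n0 * x\<^sup>2"
      using x by (simp add: field_simps)
    define n where "n = (LEAST n. D < (1 + c) ^ n * x\<^sup>2)"
    have n: "D < (1 + c) ^ n * x\<^sup>2"
      unfolding n_def by (rule LeastI[of "\<lambda>n. D < (1 + c) ^ n * x\<^sup>2", OF n0])
    have "n * sqrt x \<le> max 1 (C * D)"
    proof (cases n)
      case (Suc m)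
      then have "\<not> D < (1 + c) ^ m * x\<^sup>2"
        using not_less_Least[of m "\<lambda>n. D < (1 + c) ^ n * x\<^sup>2"] by (simp add: n_def)
      then have m: "(1 + c) ^ m * x\<^sup>2 \<le> D" by simp
      have "sqrt x ^ 4 = (sqrt x ^ 2) ^ 2"
        by (simp only: power_mult[symmetric]) simp
      then have sq: "sqrt x ^ 4 = x\<^sup>2"
        using x by simp
      have "(n * sqrt x) ^ 4 = real (Suc m) ^ 4 * x\<^sup>2"
        using Suc sq by (simp add: power_mult_distrib)
      also have "\<dots> \<le> (C * (1 + c) ^ m) * x\<^sup>2"
        by (intro mult_right_mono C') simp
      also have "\<dots> = C * ((1 + c) ^ m * x\<^sup>2)"
        by simp
      also have "\<dots> \<le> C * D"
        using m C by (intro mult_left_mono) auto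
      finally have 4: "(n * sqrt x) ^ 4 \<le> C * D" .
      show ?thesis
      proof (cases "n * sqrt x \<le> 1")
        case False
        then have "(n * sqrt x) ^ 1 \<le> (n * sqrt x) ^ 4"
          by (intro power_increasing) auto
        with 4 show ?thesis by simp
      qed simp
    qed simp
    with n show "\<exists>n. D < (1 + c) ^ n * x\<^sup>2 \<and> real n * sqrt x \<le> max 1 (C * D)"
      by blast
  qed simp
qed

text \<open>Members of a countable base separate the points of a T1 space.\<close>

lemma standard_borel_separating:
  assumes "standard_borel M" and "space M \<noteq> {}"
  obtains U :: "nat \<Rightarrow> 'a set" where "\<And>s. U s \<in> sets M"
    and "\<And>x y. x \<in> space M \<Longrightarrow> y \<in> space M \<Longrightarrow> x \<noteq> y \<Longrightarrow> \<exists>s. x \<in> U s \<and> y \<notin> U s"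
proof -
  obtain T where T: "completely_metrizable_space T" "second_countable T" "topspace T = space M"
    "sets M = sigma_sets (topspace T) {U. openin T U}"
    using assms(1) by (auto simp: standard_borel_def)
  obtain B where B: "countable B" "\<And>V. V \<in> B \<Longrightarrow> openin T V"
    "\<And>V x. openin T V \<Longrightarrow> x \<in> V \<Longrightarrow> \<exists>W\<in>B. x \<in> W \<and> W \<subseteq> V"
    using T(2) unfolding second_countable_def by metis
  have "t1_space T"
    using T(1) by (simp add: completely_metrizable_imp_metrizable_space metrizable_imp_t1_space)
  \<comment> \<open>Inserting \<open>space M\<close> makes the enumerated family nonempty.\<close>
  define U where "U = from_nat_into (insert (space M) B)"
  have ran: "range U = insert (space M) B"
    unfolding U_def using B(1) by (intro range_from_nat_into) auto
  show ?thesis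
  proof (rule that)
    fix s
    have "U s \<in> insert (space M) B"
      using ran by auto
    then show "U s \<in> sets M"
      using B(2) T(4) by auto
  next
    fix x y assume "x \<in> space M" "y \<in> space M" "x \<noteq> y"
    then obtain V where "openin T V" "x \<in> V" "y \<notin> V"
      using \<open>t1_space T\<close> T(3) unfolding t1_space_def by metis
    then obtain W where "W \<in> B" "x \<in> W" "y \<notin> W"
      using B(3) by blast
    then show "\<exists>s. x \<in> U s \<and> y \<notin> U s"
      using ran by (metis insertI2 rangeE)
  qed
qed

lemma ecard_eq_enat_iff: "ecard S = enat n \<longleftrightarrow> finite S \<and> card S = n"
  by (simp add: ecard_def)

section \<open>The edge measure\<close>

text \<open>The involutions \<open>f\<close> generating the graph and the separating family
  \<open>U\<close> are fixed once and for all. From here on the Polish topology enters only through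
  \<open>U\<close>.\<close>

locale mp_regular_graph = prob_space M for M :: "'a measure" +
  fixes G :: "('a \<times> 'a) set" and d :: nat and f :: "nat \<Rightarrow> 'a \<Rightarrow> 'a" and U :: "nat \<Rightarrow> 'a set"
  assumes f_measurable [measurable]: "\<And>n. f n \<in> M \<rightarrow>\<^sub>M M"
    and f_involution: "\<And>n x. x \<in> space M \<Longrightarrow> f n (f n x) = x"
    and f_preserving: "\<And>n. distr M M (f n) = M"
    and G_eq: "G = (\<Union>n. involution_graph (space M) (f n))"
    and G_sets [measurable]: "G \<in> sets (M \<Otimes>\<^sub>M M)"
    and G_finite: "\<And>x. x \<in> space M \<Longrightarrow> finite (G `` {x})"
    and G_degree: "\<And>x. x \<in> space M \<Longrightarrow> card (G `` {x}) = d"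
    and U_sets [measurable]: "\<And>s. U s \<in> sets M"
    and U_separating: "\<And>x y. x \<in> space M \<Longrightarrow> y \<in> space M \<Longrightarrow> x \<noteq> y \<Longrightarrow> \<exists>s. x \<in> U s \<and> y \<notin> U s"
begin

lemma f_space [simp]: "x \<in> space M \<Longrightarrow> f n x \<in> space M"
  using f_measurable by (rule measurable_space)

lemma G_iff: "(x, y) \<in> G \<longleftrightarrow> x \<in> space M \<and> x \<noteq> y \<and> (\<exists>n. y = f n x)"
  by (auto simp: G_eq involution_graph_def)

lemma G_subset: "G \<subseteq> space M \<times> space M"
  by (auto simp: G_iff)

lemma G_symD: "(x, y) \<in> G \<Longrightarrow> (y, x) \<in> G"
  by (auto simp: G_iff) (metis f_involution)

lemma G_converse: "G\<inverse> = G"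
  by (auto dest: G_symD)

text \<open>The complement of the diagonal is the countable union of the rectangles on which
  \<open>U s\<close> contains the first point and not the second.\<close>

lemma diagonal_sets: "{p \<in> space (M \<Otimes>\<^sub>M M). fst p = snd p} \<in> sets (M \<Otimes>\<^sub>M M)"
proof -
  have "{p \<in> space (M \<Otimes>\<^sub>M M). fst p = snd p} = space (M \<Otimes>\<^sub>M M) - (\<Union>s. U s \<times> (space M - U s))"
    by (auto simp: space_pair_measure) (metis U_separating)
  then show ?thesis
    by simp
qed

lemma equalizer_sets [measurable (raw)]:
  assumes [measurable]: "g \<in> N \<rightarrow>\<^sub>M M" "h \<in> N \<rightarrow>\<^sub>M M"
  shows "Measurable.pred N (\<lambda>x. g x = h x)"
proof -
  have "(\<lambda>x. (g x, h x)) -` {p \<in> space (M \<Otimes>\<^sub>M M). fst p = snd p} \<inter> space N \<in> sets N"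
    by (rule measurable_sets[OF _ diagonal_sets]) measurable
  also have "(\<lambda>x. (g x, h x)) -` {p \<in> space (M \<Otimes>\<^sub>M M). fst p = snd p} \<inter> space N = {x \<in> space N. g x = h x}"
    using measurable_space[OF assms(1)] measurable_space[OF assms(2)] by (auto simp: space_pair_measure)
  finally show ?thesis
    by (simp add: pred_def)
qed

definition edge_set :: "('a \<times> 'a) set \<Rightarrow> bool" where
  "edge_set r \<longleftrightarrow> r \<in> sets (M \<Otimes>\<^sub>M M) \<and> r \<subseteq> G"

lemma edge_set_sets [measurable_dest]: "edge_set r \<Longrightarrow> r \<in> sets (M \<Otimes>\<^sub>M M)"
  and edge_set_subset: "edge_set r \<Longrightarrow> r \<subseteq> G"
  by (auto simp: edge_set_def)

lemma edge_set_G: "edge_set G"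
  by (simp add: edge_set_def)

lemma converse_sets:
  assumes [measurable]: "r \<in> sets (M \<Otimes>\<^sub>M M)"
  shows "r\<inverse> \<in> sets (M \<Otimes>\<^sub>M M)"
proof -
  have "r\<inverse> = {p \<in> space (M \<Otimes>\<^sub>M M). (snd p, fst p) \<in> r}"
    using sets.sets_into_space[OF assms] by (auto simp: space_pair_measure)
  also have "\<dots> \<in> sets (M \<Otimes>\<^sub>M M)"
    by measurable
  finally show ?thesis .
qed

lemma edge_set_converse: "edge_set r \<Longrightarrow> edge_set (r\<inverse>)"
  using converse_sets G_symD by (auto simp: edge_set_def)

lemma edge_set_Diff: "edge_set r \<Longrightarrow> r' \<in> sets (M \<Otimes>\<^sub>M M) \<Longrightarrow> edge_set (r - r')"
  and edge_set_Un: "edge_set r \<Longrightarrow> edge_set s \<Longrightarrow> edge_set (r \<union> s)"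
  and edge_set_Int: "edge_set r \<Longrightarrow> r' \<in> sets (M \<Otimes>\<^sub>M M) \<Longrightarrow> edge_set (r \<inter> r')"
  by (auto simp: edge_set_def)

lemma edge_set_finite: "edge_set r \<Longrightarrow> finite (r `` {x})"
proof (cases "x \<in> space M")
  case True
  moreover assume "edge_set r"
  ultimately show ?thesis
    by (meson G_finite Image_mono edge_set_subset finite_subset subset_refl)
next
  case False
  moreover assume "edge_set r"
  ultimately have "r `` {x} = {}"
    using G_subset by (auto simp: edge_set_def)
  then show ?thesis by simp
qed

lemma edge_set_card_le: "edge_set r \<Longrightarrow> card (r `` {x}) \<le> d"
proof (cases "x \<in> space M")
  case True
  moreover assume r: "edge_set r"
  ultimately show ?thesis
    by (metis G_degree G_finite Image_mono card_mono edge_set_subset subset_refl)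
next
  case False
  moreover assume "edge_set r"
  ultimately have "r `` {x} = {}"
    using G_subset by (auto simp: edge_set_def)
  then show ?thesis by simp
qed

section \<open>Counting neighbours by slices of single involutions\<close>

definition new_at :: "nat \<Rightarrow> 'a \<Rightarrow> bool" where
  "new_at n x \<longleftrightarrow> (\<forall>m<n. f m x \<noteq> f n x)"

lemma new_at_measurable [measurable]: "Measurable.pred M (new_at n)"
  unfolding new_at_def by measurable

text \<open>Applying \<open>f m\<close> to \<open>f m x = f n x\<close> gives
  \<open>f m (f n x) = x\<close>, and conversely. So the least index that realizes an edge is the
  same from both of its ends, which makes slices compatible with converses.\<close>

lemma new_at_involution: "x \<in> space M \<Longrightarrow> new_at n (f n x) \<longleftrightarrow> new_at n x"
proof -
  assume x: "x \<in> space M"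
  have "f m (f n x) = f n (f n x) \<longleftrightarrow> f m x = f n x" for m
    using f_involution[OF x, of m] f_involution[OF x, of n] f_involution[of "f n x" m] x
    by (metis f_space)
  then show ?thesis
    by (simp add: new_at_def)
qed

text \<open>Several involutions may join \<open>x\<close> to the same neighbour;
  \<open>new_at\<close> keeps the least index, so each edge of \<open>r\<close> lies in exactly one
  slice when \<open>r\<close> is contained in \<open>G\<close>.\<close>

definition slice :: "('a \<times> 'a) set \<Rightarrow> nat \<Rightarrow> 'a set" where
  "slice r n = {x \<in> space M. new_at n x \<and> (x, f n x) \<in> r}"

lemma slice_sets [measurable]:
  assumes [measurable]: "r \<in> sets (M \<Otimes>\<^sub>M M)"
  shows "slice r n \<in> sets M"
  unfolding slice_def by measurable

text \<open>The map taking \<open>n\<close> to \<open>f n x\<close> is a bijection from the indices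
  of the slices containing \<open>x\<close> onto the section of \<open>r\<close> at
  \<open>x\<close>: \<open>new_at\<close> makes it injective, and least indices make it
  surjective.\<close>

lemma card_section_eq:
  assumes r: "edge_set r" and x: "x \<in> space M"
  shows "ennreal (real (card (r `` {x}))) = (\<Sum>n. indicator (slice r n) x)"
proof -
  define I where "I = {n. x \<in> slice r n}"
  have inj: "inj_on (\<lambda>n. f n x) I"
  proof (rule inj_onI)
    fix m n assume "m \<in> I" "n \<in> I" "f m x = f n x"
    then show "m = n"
      by (cases m n rule: linorder_cases) (auto simp: I_def slice_def new_at_def)
  qed
  have img: "(\<lambda>n. f n x) ` I = r `` {x}"
  proof (intro set_eqI iffI)
    fix y assume "y \<in> r `` {x}"
    then have y: "(x, y) \<in> r" by simp
    then have "(x, y) \<in> G"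
      using r by (auto simp: edge_set_def)
    then obtain n where n: "f n x = y"
      by (auto simp: G_iff)
    define l where "l = (LEAST n. f n x = y)"
    have l: "f l x = y"
      unfolding l_def by (rule LeastI[of "\<lambda>n. f n x = y", OF n])
    moreover have "new_at l x"
      using l by (auto simp: new_at_def l_def dest: not_less_Least)
    ultimately show "y \<in> (\<lambda>n. f n x) ` I"
      using y x by (auto simp: I_def slice_def)
  qed (auto simp: I_def slice_def)
  have fin: "finite I"
    using finite_imageD[OF _ inj] edge_set_finite[OF r] by (simp add: img)
  have "ennreal (real (card (r `` {x}))) = emeasure (count_space UNIV) I"
    using fin card_image[OF inj] by (simp add: img emeasure_count_space ennreal_of_nat_eq_real_of_nat)
  also have "\<dots> = (\<integral>\<^sup>+n. indicator I n \<partial>count_space UNIV)"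
    by simp
  also have "\<dots> = (\<Sum>n. indicator I n)"
    by (rule nn_integral_count_space_nat)
  also have "\<dots> = (\<Sum>n. indicator (slice r n) x)"
    by (simp add: I_def indicator_def)
  finally show ?thesis .
qed

text \<open>The countable sum of slice indicators does the work of the Lusin--Novikov
  theorem.\<close>

lemma card_section_measurable [measurable (raw)]:
  assumes r: "edge_set r"
  shows "(\<lambda>x. card (r `` {x})) \<in> M \<rightarrow>\<^sub>M count_space UNIV"
proof -
  note [measurable] = edge_set_sets[OF r]
  have *: "(\<lambda>x. \<Sum>n. indicator (slice r n) x :: ennreal) \<in> borel_measurable M"
    by measurable
  have "{x \<in> space M. card (r `` {x}) = j} \<in> sets M" for j
  proof -
    have "{x \<in> space M. card (r `` {x}) = j} = {x \<in> space M. (\<Sum>n. indicator (slice r n) x :: ennreal) = ennreal (real j)}"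
      using card_section_eq[OF r, symmetric] by auto
    also have "\<dots> \<in> sets M"
      using * by measurable
    finally show ?thesis .
  qed
  then show ?thesis
    by (subst measurable_count_space_eq2_countable) (auto simp: vimage_def Int_def conj_commute)
qed

lemma edge_set_integrable: "edge_set r \<Longrightarrow> integrable M (\<lambda>x. real (card (r `` {x})))"
  by (rule integrable_const_bound[of _ "real d"]) (auto simp: edge_set_card_le)

text \<open>This is the measure of directed edges obtained by integrating the number of
  out-neighbours. Intersecting with \<open>G\<close> makes it defined on the whole product
  sigma-algebra, with all mass on \<open>G\<close>.\<close>

definition edge_measure :: "('a \<times> 'a) measure" where
  "edge_measure = measure_of (space M \<times> space M) (sets (M \<Otimes>\<^sub>M M))
     (\<lambda>r. \<integral>\<^sup>+x. ennreal (real (card ((r \<inter> G) `` {x}))) \<partial>M)"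

lemma sets_edge_measure [measurable_cong, simp]: "sets edge_measure = sets (M \<Otimes>\<^sub>M M)"
  and space_edge_measure [simp]: "space edge_measure = space M \<times> space M"
proof -
  have "sets (M \<Otimes>\<^sub>M M) \<subseteq> Pow (space M \<times> space M)"
    by (metis sets.space_closed space_pair_measure)
  then show "sets edge_measure = sets (M \<Otimes>\<^sub>M M)" "space edge_measure = space M \<times> space M"
    unfolding edge_measure_def
    by (simp_all add: sets_measure_of space_measure_of flip: space_pair_measure)
qed

lemma nn_integral_card_section:
  assumes r: "edge_set r"
  shows "(\<integral>\<^sup>+x. ennreal (real (card (r `` {x}))) \<partial>M) = (\<Sum>n. emeasure M (slice r n))"
proof -
  note [measurable] = edge_set_sets[OF r]
  have "(\<integral>\<^sup>+x. ennreal (real (card (r `` {x}))) \<partial>M) = (\<integral>\<^sup>+x. (\<Sum>n. indicator (slice r n) x) \<partial>M)"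
    by (intro nn_integral_cong card_section_eq[OF r])
  also have "\<dots> = (\<Sum>n. \<integral>\<^sup>+x. indicator (slice r n) x \<partial>M)"
    by (rule nn_integral_suminf) measurable
  also have "\<dots> = (\<Sum>n. emeasure M (slice r n))"
    by simp
  finally show ?thesis .
qed

lemma emeasure_edge_measure_slice:
  assumes "r \<in> sets (M \<Otimes>\<^sub>M M)"
  shows "emeasure edge_measure r = (\<Sum>n. emeasure M (slice (r \<inter> G) n))"
proof -
  have eq: "(\<integral>\<^sup>+x. ennreal (real (card ((r \<inter> G) `` {x}))) \<partial>M) = (\<Sum>n. emeasure M (slice (r \<inter> G) n))"
    if "r \<in> sets (M \<Otimes>\<^sub>M M)" for r
    using that by (intro nn_integral_card_section) (auto simp: edge_set_def)
  have "emeasure edge_measure r = (\<integral>\<^sup>+x. ennreal (real (card ((r \<inter> G) `` {x}))) \<partial>M)"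
  proof (rule emeasure_measure_of[OF edge_measure_def])
    show "sets (M \<Otimes>\<^sub>M M) \<subseteq> Pow (space M \<times> space M)"
      by (metis sets.space_closed space_pair_measure)
    show "r \<in> sets edge_measure"
      using assms by simp
    show "countably_additive (sets edge_measure) (\<lambda>r. \<integral>\<^sup>+x. ennreal (real (card ((r \<inter> G) `` {x}))) \<partial>M)"
    proof (rule countably_additiveI)
      fix A :: "nat \<Rightarrow> ('a \<times> 'a) set"
      assume A: "range A \<subseteq> sets edge_measure" and disj: "disjoint_family A"
      then have A': "A i \<in> sets (M \<Otimes>\<^sub>M M)" for i by auto
      note [measurable] = A'
      have d: "disjoint_family (\<lambda>i. slice (A i \<inter> G) n)" for n
        using disj by (auto simp: disjoint_family_on_def slice_def)
      have "(\<Sum>i. \<integral>\<^sup>+x. ennreal (real (card ((A i \<inter> G) `` {x}))) \<partial>M)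
          = (\<Sum>i. \<Sum>n. emeasure M (slice (A i \<inter> G) n))"
        using eq A' by simp
      \<comment> \<open>The two sums are exchanged by reading the inner one as an integral against
        counting measure; for each fixed \<open>n\<close> the slices of the disjoint sets
        \<open>A i\<close> are disjoint.\<close>
      also have "\<dots> = (\<Sum>i. \<integral>\<^sup>+n. emeasure M (slice (A i \<inter> G) n) \<partial>count_space UNIV)"
        by (simp add: nn_integral_count_space_nat)
      also have "\<dots> = (\<integral>\<^sup>+n. (\<Sum>i. emeasure M (slice (A i \<inter> G) n)) \<partial>count_space UNIV)"
        by (rule nn_integral_suminf[symmetric]) simp
      also have "\<dots> = (\<Sum>n. \<Sum>i. emeasure M (slice (A i \<inter> G) n))"
        by (simp add: nn_integral_count_space_nat)
      also have "\<dots> = (\<Sum>n. emeasure M (\<Union>i. slice (A i \<inter> G) n))"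
        using d by (subst suminf_emeasure) auto
      also have "\<dots> = (\<Sum>n. emeasure M (slice ((\<Union>i. A i) \<inter> G) n))"
        by (intro arg_cong[where f = suminf] ext arg_cong[where f = "emeasure M"]) (auto simp: slice_def)
      also have "\<dots> = (\<integral>\<^sup>+x. ennreal (real (card (((\<Union>i. A i) \<inter> G) `` {x}))) \<partial>M)"
        using A' by (subst eq) auto
      finally show "(\<Sum>i. \<integral>\<^sup>+x. ennreal (real (card ((A i \<inter> G) `` {x}))) \<partial>M)
          = (\<integral>\<^sup>+x. ennreal (real (card (((\<Union>i. A i) \<inter> G) `` {x}))) \<partial>M)" .
    qed
  qed (simp add: positive_def)
  then show ?thesis
    using eq assms by simp
qed

lemma emeasure_edge_measure:
  "edge_set r \<Longrightarrow> emeasure edge_measure r = (\<integral>\<^sup>+x. ennreal (real (card (r `` {x}))) \<partial>M)"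
  using nn_integral_card_section[of r]
  by (simp add: emeasure_edge_measure_slice edge_set_def Int_absorb2)

lemma measure_edge_measure:
  assumes r: "edge_set r"
  shows "measure edge_measure r = (\<integral>x. real (card (r `` {x})) \<partial>M)"
proof -
  have "emeasure edge_measure r = ennreal (\<integral>x. real (card (r `` {x})) \<partial>M)"
    using emeasure_edge_measure[OF r] nn_integral_eq_integral[OF edge_set_integrable[OF r]] by simp
  then show ?thesis
    by (simp add: measure_def integral_nonneg_AE)
qed

lemma edge_measure_G: "emeasure edge_measure G = ennreal d" "measure edge_measure G = d"
proof -
  have "emeasure edge_measure G = (\<integral>\<^sup>+x. ennreal d \<partial>M)"
    unfolding emeasure_edge_measure[OF edge_set_G] by (intro nn_integral_cong) (simp add: G_degree)
  then show "emeasure edge_measure G = ennreal d"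
    by (simp add: emeasure_space_1)
  then show "measure edge_measure G = d"
    by (simp add: measure_def)
qed

sublocale N: finite_measure edge_measure
proof
  have "space M \<times> space M \<in> sets (M \<Otimes>\<^sub>M M)"
    by simp
  then have "emeasure edge_measure (space M \<times> space M) = emeasure edge_measure G"
    using G_subset by (simp add: emeasure_edge_measure_slice Int_absorb1)
  then show "emeasure edge_measure (space edge_measure) \<noteq> \<infinity>"
    by (simp add: edge_measure_G)
qed

text \<open>Mass transport: each involution swaps a slice of \<open>r\<close> with the same slice of its converse.\<close>

lemma edge_measure_converse:
  assumes r: "edge_set r"
  shows "measure edge_measure (r\<inverse>) = measure edge_measure r"
proof -
  note [measurable] = edge_set_sets[OF r] edge_set_sets[OF edge_set_converse[OF r]]
  have "emeasure M (slice (r\<inverse>) n) = emeasure M (slice r n)" for n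
  proof -
    have "emeasure M (slice r n) = emeasure (distr M M (f n)) (slice r n)"
      by (simp add: f_preserving)
    also have "\<dots> = emeasure M (f n -` slice r n \<inter> space M)"
      by (rule emeasure_distr) measurable
    also have "f n -` slice r n \<inter> space M = slice (r\<inverse>) n"
      by (auto simp: slice_def new_at_involution f_involution)
    finally show ?thesis by simp
  qed
  moreover have "r\<inverse> \<inter> G = r\<inverse>" "r \<inter> G = r"
    using r edge_set_converse[OF r] by (auto simp: edge_set_def)
  ultimately have "emeasure edge_measure (r\<inverse>) = emeasure edge_measure r"
    by (simp add: emeasure_edge_measure_slice)
  then show ?thesis
    by (simp add: measure_def)
qed

section \<open>Edges at a given set of vertices\<close>

lemma section_restrict:
  assumes r: "edge_set r" and B [measurable]: "B \<in> sets M"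
  shows "measure edge_measure (r \<inter> B \<times> space M) = (\<integral>x. indicator B x * real (card (r `` {x})) \<partial>M)"
proof -
  have e: "edge_set (r \<inter> B \<times> space M)"
    by (rule edge_set_Int[OF r]) simp
  have "(r \<inter> B \<times> space M) `` {x} = (if x \<in> B then r `` {x} else {})" for x
    using edge_set_subset[OF r] G_subset by auto
  then show ?thesis
    unfolding measure_edge_measure[OF e] by (intro Bochner_Integration.integral_cong) auto
qed

lemma section_restrict_integrable:
  assumes r: "edge_set r" and B [measurable]: "B \<in> sets M"
  shows "integrable M (\<lambda>x. indicator B x * real (card (r `` {x})))"
  using integrable_mult_indicator[OF B edge_set_integrable[OF r]] by simp

lemma section_restrict_le:
  assumes r: "edge_set r" and B [measurable]: "B \<in> sets M"
    and le: "AE x in M. x \<in> B \<longrightarrow> real (card (r `` {x})) \<le> c"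
  shows "measure edge_measure (r \<inter> B \<times> space M) \<le> c * prob B"
proof -
  have i: "integrable M (\<lambda>x. indicator B x * c)"
    by (simp add: emeasure_eq_measure)
  have "(\<integral>x. indicator B x * real (card (r `` {x})) \<partial>M) \<le> (\<integral>x. indicator B x * c \<partial>M)"
    using le by (intro integral_mono_AE section_restrict_integrable r B i) (auto simp: indicator_def)
  then show ?thesis
    by (simp add: section_restrict[OF r B] mult.commute)
qed

lemma section_restrict_ge:
  assumes r: "edge_set r" and B [measurable]: "B \<in> sets M"
    and ge: "AE x in M. x \<in> B \<longrightarrow> c \<le> real (card (r `` {x}))"
  shows "c * prob B \<le> measure edge_measure (r \<inter> B \<times> space M)"
proof -
  have i: "integrable M (\<lambda>x. indicator B x * c)"
    by (simp add: emeasure_eq_measure)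
  have "(\<integral>x. indicator B x * c \<partial>M) \<le> (\<integral>x. indicator B x * real (card (r `` {x})) \<partial>M)"
    using ge by (intro integral_mono_AE section_restrict_integrable r B i) (auto simp: indicator_def)
  then show ?thesis
    by (simp add: section_restrict[OF r B] mult.commute)
qed

lemma G_restrict_le:
  assumes B: "B \<in> sets M"
  shows "measure edge_measure (G \<inter> B \<times> space M) \<le> d * prob B"
  by (rule section_restrict_le[OF edge_set_G B]) (simp add: G_degree)

lemma edge_measure_reverse:
  assumes r: "edge_set r" and [measurable]: "A \<in> sets M" "B \<in> sets M"
  shows "measure edge_measure (r \<inter> A \<times> B) = measure edge_measure (r\<inverse> \<inter> B \<times> A)"
proof -
  have "(r \<inter> A \<times> B)\<inverse> = r\<inverse> \<inter> B \<times> A"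
    by auto
  then show ?thesis
    using edge_measure_converse[OF edge_set_Int[OF r, of "A \<times> B"]] by simp
qed

lemma edge_measure_split:
  assumes r: "edge_set r" and [measurable]: "A \<in> sets M" "B \<in> sets M"
  shows "measure edge_measure (r \<inter> A \<times> space M)
    = measure edge_measure (r \<inter> A \<times> B) + measure edge_measure (r \<inter> A \<times> (space M - B))"
proof -
  note [measurable] = edge_set_sets[OF r]
  have "r \<inter> A \<times> space M = (r \<inter> A \<times> B) \<union> (r \<inter> A \<times> (space M - B))"
    using sets.sets_into_space[of B M] by auto
  then show ?thesis
    by (simp, intro N.finite_measure_Union) auto
qed

text \<open>Lower bound for the orientation number: apart from edges meeting the complement of
  \<open>A\<close>, the graph is covered by \<open>r\<close> and its converse. These have equal
  measure, at most \<open>s\<close>, whereas \<open>G\<close> has measure \<open>d\<close>.\<close>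

lemma orientation_outdegree_ge:
  assumes [measurable]: "r \<in> sets (M \<Otimes>\<^sub>M M)" "A \<in> sets M" and null: "emeasure M (space M - A) = 0"
    and ori: "orientation (G \<inter> A \<times> A) r" and le: "\<And>x. x \<in> A \<Longrightarrow> card (r `` {x}) \<le> s"
  shows "d \<le> 2 * s"
proof -
  have sub: "r \<subseteq> G \<inter> A \<times> A" and cov: "G \<inter> A \<times> A \<subseteq> r \<union> r\<inverse>"
    using ori by (auto simp: orientation_def)
  have r: "edge_set r"
    using sub by (auto simp: edge_set_def)
  have z: "measure edge_measure (G \<inter> (space M - A) \<times> space M) = 0"
  proof -
    have "measure edge_measure (G \<inter> (space M - A) \<times> space M) \<le> 0"
      using G_restrict_le[of "space M - A"] null by (simp add: measure_def)
    then show ?thesis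
      by (simp add: antisym)
  qed
  \<comment> \<open>Edges that end in the null set are the converses of those that start there, so
    mass transport makes them negligible too.\<close>
  then have z': "measure edge_measure (G \<inter> space M \<times> (space M - A)) = 0"
    using edge_measure_reverse[OF edge_set_G, of "space M" "space M - A"] by (simp add: G_converse)
  have N: "measure edge_measure r \<le> s"
  proof -
    have "card (r `` {x}) \<le> s" for x
    proof (cases "x \<in> A")
      case False
      then have "r `` {x} = {}"
        using sub by auto
      then show ?thesis by simp
    qed (rule le)
    then have "(\<integral>x. real (card (r `` {x})) \<partial>M) \<le> (\<integral>x. real s \<partial>M)"
      by (intro integral_mono edge_set_integrable r) auto
    then show ?thesis
      by (simp add: measure_edge_measure[OF r] prob_space)
  qed
  let ?a = "G \<inter> (space M - A) \<times> space M" and ?b = "G \<inter> space M \<times> (space M - A)"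
  have c [measurable]: "r\<inverse> \<in> sets (M \<Otimes>\<^sub>M M)"
    by (rule converse_sets) simp
  have "real d = measure edge_measure G"
    by (simp add: edge_measure_G)
  also have "\<dots> \<le> measure edge_measure ((?a \<union> ?b) \<union> (r \<union> r\<inverse>))"
    using cov G_subset by (intro N.finite_measure_mono) auto
  also have "\<dots> \<le> measure edge_measure (?a \<union> ?b) + measure edge_measure (r \<union> r\<inverse>)"
    by (intro measure_Un_le) auto
  also have "\<dots> \<le> (measure edge_measure ?a + measure edge_measure ?b) + (measure edge_measure r + measure edge_measure (r\<inverse>))"
    by (intro add_mono measure_Un_le) auto
  also have "\<dots> \<le> real s + real s"
    using N by (simp add: z z' edge_measure_converse[OF r])
  finally show ?thesis
    by linarith
qed

section \<open>Strict orientations and expansion\<close>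

definition strict_orientation :: "('a \<times> 'a) set \<Rightarrow> bool" where
  "strict_orientation r \<longleftrightarrow> r \<in> sets (M \<Otimes>\<^sub>M M) \<and> r \<union> r\<inverse> = G \<and> r \<inter> r\<inverse> = {}"

lemma strict_orientation_edge_set: "strict_orientation r \<Longrightarrow> edge_set r"
  by (auto simp: strict_orientation_def edge_set_def)

lemma strict_orientation_degree:
  assumes r: "strict_orientation r" and x: "x \<in> space M"
  shows "card (r `` {x}) + card (r\<inverse> `` {x}) = d"
proof -
  have e: "edge_set r" "edge_set (r\<inverse>)"
    using r strict_orientation_edge_set edge_set_converse by auto
  have "G `` {x} = r `` {x} \<union> r\<inverse> `` {x}" "r `` {x} \<inter> r\<inverse> `` {x} = {}"
    using r by (auto simp: strict_orientation_def)
  then have "card (G `` {x}) = card (r `` {x}) + card (r\<inverse> `` {x})"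
    using edge_set_finite[OF e(1)] edge_set_finite[OF e(2)] by (metis card_Un_disjoint)
  then show ?thesis
    using G_degree[OF x] by simp
qed

text \<open>The graph splits into \<open>r\<close> and its converse, of equal measure. Hence the
  mean outdegree is half the degree.\<close>

lemma strict_orientation_measure:
  assumes r: "strict_orientation r"
  shows "measure edge_measure r = d / 2"
proof -
  have e: "edge_set r" "edge_set (r\<inverse>)"
    using r strict_orientation_edge_set edge_set_converse by auto
  have "measure edge_measure G = measure edge_measure r + measure edge_measure (r\<inverse>)"
    using r e edge_set_sets by (subst N.finite_measure_Union[symmetric]) (auto simp: strict_orientation_def)
  then show ?thesis
    by (simp add: edge_measure_G edge_measure_converse[OF e(1)])
qed

text \<open>Stated as a product instead of a quotient, so that null sets need no exception.\<close>

definition expanding :: "real \<Rightarrow> bool" where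
  "expanding l \<longleftrightarrow> 0 < l \<and> (\<forall>A\<in>sets M. prob A \<le> 1 / 2 \<longrightarrow>
     l * prob A \<le> measure edge_measure (G \<inter> A \<times> (space M - A)))"

text \<open>Apply expansion to whichever of \<open>B\<close> and its complement has measure at most
  one half; mass transport shows that both have the same boundary measure. The product form treats
  the growth of small sets and the shrinking of small complements at once.\<close>

lemma expanding_boundary:
  assumes l: "expanding l" and B [measurable]: "B \<in> sets M"
  shows "l * (prob B * (1 - prob B)) \<le> measure edge_measure (G \<inter> B \<times> (space M - B))"
proof (cases "prob B \<le> 1 / 2")
  case True
  have "l * (prob B * (1 - prob B)) \<le> l * (prob B * 1)"
    using l by (intro mult_left_mono) (auto simp: expanding_def)
  also have "\<dots> \<le> measure edge_measure (G \<inter> B \<times> (space M - B))"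
    using l B True by (auto simp: expanding_def)
  finally show ?thesis .
next
  case False
  have c: "prob (space M - B) = 1 - prob B"
    by (simp add: prob_compl)
  have "l * (prob B * (1 - prob B)) \<le> l * (1 * (1 - prob B))"
    using l by (intro mult_left_mono mult_right_mono) (auto simp: expanding_def)
  also have "\<dots> \<le> measure edge_measure (G \<inter> (space M - B) \<times> (space M - (space M - B)))"
  proof -
    have "space M - B \<in> sets M" "prob (space M - B) \<le> 1 / 2"
      using False c by auto
    then have "l * prob (space M - B) \<le> measure edge_measure (G \<inter> (space M - B) \<times> (space M - (space M - B)))"
      using l unfolding expanding_def by blast
    then show ?thesis
      by (simp add: c)
  qed
  also have "space M - (space M - B) = B"
    using sets.sets_into_space[OF B] by auto
  also have "measure edge_measure (G \<inter> (space M - B) \<times> B) = measure edge_measure (G \<inter> B \<times> (space M - B))"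
    using edge_measure_reverse[OF edge_set_G, of "space M - B" B] by (simp add: G_converse)
  finally show ?thesis .
qed

text \<open>
  Since \<open>2 * k \<ge> d\<close>, at least as many edges leave \<open>B\<close> as enter it, hence at least half of the
  boundary leaves \<open>B\<close>.
\<close>

lemma out_neighbourhood_growth:
  assumes r: "strict_orientation r" and k: "d \<le> 2 * k" and l: "expanding l" and d: "0 < d"
    and B [measurable]: "B \<in> sets M" and C [measurable]: "C \<in> sets M"
    and sub: "B \<subseteq> C" "r `` B \<subseteq> C"
    and ge: "AE x in M. x \<in> B \<longrightarrow> k \<le> card (r `` {x})"
  shows "prob B + l / (2 * d) * (prob B * (1 - prob B)) \<le> prob C"
proof -
  let ?N = "measure edge_measure"
  let ?X = "space M"
  have e: "edge_set r" "edge_set (r\<inverse>)"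
    using r strict_orientation_edge_set edge_set_converse by auto
  note [measurable] = edge_set_sets[OF e(1)] edge_set_sets[OF e(2)]
  have G: "G = r \<union> r\<inverse>" "r \<inter> r\<inverse> = {}"
    using r by (auto simp: strict_orientation_def)
  have 1: "k * prob B \<le> ?N (r \<inter> B \<times> B) + ?N (r \<inter> B \<times> (?X - B))"
    using section_restrict_ge[OF e(1) B, of k] ge edge_measure_split[OF e(1) B B] by simp
  have "AE x in M. x \<in> B \<longrightarrow> real (card (r\<inverse> `` {x})) \<le> real d - real k"
    using ge AE_space by eventually_elim (use strict_orientation_degree[OF r] in fastforce)
  from section_restrict_le[OF e(2) B this]
  have 2: "?N (r \<inter> B \<times> B) + ?N (r\<inverse> \<inter> B \<times> (?X - B)) \<le> (real d - real k) * prob B"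
    using edge_measure_split[OF e(2) B B] edge_measure_reverse[OF e(1) B B] by simp
  have 3: "?N (G \<inter> B \<times> (?X - B)) = ?N (r \<inter> B \<times> (?X - B)) + ?N (r\<inverse> \<inter> B \<times> (?X - B))"
  proof -
    have "G \<inter> B \<times> (?X - B) = r \<inter> B \<times> (?X - B) \<union> r\<inverse> \<inter> B \<times> (?X - B)"
      by (auto simp: G(1))
    then show ?thesis
      using G(2) by (simp, intro N.finite_measure_Union) auto
  qed
  \<comment> \<open>In \<open>1\<close> and \<open>2\<close> the edges inside \<open>B\<close>
    contribute the same amount, so what remains compares the edges leaving \<open>B\<close> with
    those entering it.\<close>
  have "(real d - real k) * prob B \<le> real k * prob B"
    using k by (intro mult_right_mono) auto
  with 1 2 3 have 4: "?N (G \<inter> B \<times> (?X - B)) \<le> 2 * ?N (r \<inter> B \<times> (?X - B))"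
    by linarith
  have CB [measurable]: "C - B \<in> sets M"
    by simp
  \<comment> \<open>Edges of \<open>r\<close> that leave \<open>B\<close> end in
    \<open>C - B\<close>, where each vertex has only \<open>d\<close> neighbours. This gives the
    factor \<open>d\<close> in the rate \<open>l / (2 * d)\<close>; the 2 comes from
    \<open>4\<close>.\<close>
  have "?N (r \<inter> B \<times> (?X - B)) \<le> ?N (G \<inter> ?X \<times> (C - B))"
  proof (rule N.finite_measure_mono)
    show "r \<inter> B \<times> (?X - B) \<subseteq> G \<inter> ?X \<times> (C - B)"
      using sub(2) edge_set_subset[OF e(1)] G_subset by auto
  qed simp
  also have "\<dots> = ?N (G \<inter> (C - B) \<times> ?X)"
    using edge_measure_reverse[OF edge_set_G, of ?X "C - B"] by (simp add: G_converse)
  also have "\<dots> \<le> d * prob (C - B)"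
    by (rule G_restrict_le) simp
  also have "prob (C - B) = prob C - prob B"
    using sub(1) by (intro finite_measure_Diff) auto
  finally have "l * (prob B * (1 - prob B)) \<le> 2 * d * (prob C - prob B)"
    using expanding_boundary[OF l B] 4 by linarith
  then show ?thesis
    using d by (simp add: field_simps)
qed

section \<open>Augmenting paths\<close>

definition overfull :: "nat \<Rightarrow> ('a \<times> 'a) set \<Rightarrow> 'a set" where
  "overfull k r = {x \<in> space M. k < card (r `` {x})}"

definition underfull :: "nat \<Rightarrow> ('a \<times> 'a) set \<Rightarrow> 'a set" where
  "underfull k r = {x \<in> space M. card (r `` {x}) < k}"

text \<open>Subtraction of natural numbers truncates at 0, so the integrand is the positive part of
  outdegree minus \<open>k\<close>.\<close>

definition excess :: "nat \<Rightarrow> ('a \<times> 'a) set \<Rightarrow> real" where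
  "excess k r = (\<integral>x. real (card (r `` {x}) - k) \<partial>M)"

text \<open>The vertices at directed distance at most \<open>i\<close> from the overfull ones.
  Naming the predecessor as \<open>f n y\<close> turns the existential over vertices into a
  countable one, so the sets are measurable.\<close>

primrec reach :: "nat \<Rightarrow> ('a \<times> 'a) set \<Rightarrow> nat \<Rightarrow> 'a set" where
  "reach k r 0 = overfull k r"
| "reach k r (Suc i) = reach k r i \<union> {y \<in> space M. \<exists>n. (f n y, y) \<in> r \<and> f n y \<in> reach k r i}"

lemma overfull_sets [measurable]:
  assumes "edge_set r" shows "overfull k r \<in> sets M"
  unfolding overfull_def using card_section_measurable[OF assms] by measurable

lemma underfull_sets [measurable]:
  assumes "edge_set r" shows "underfull k r \<in> sets M"
  unfolding underfull_def using card_section_measurable[OF assms] by measurable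

lemma reach_sets [measurable]:
  assumes r: "edge_set r" shows "reach k r i \<in> sets M"
proof (induction i)
  case 0
  show ?case by (simp add: overfull_sets[OF r])
next
  case (Suc i)
  note [measurable] = Suc edge_set_sets[OF r]
  have "{y \<in> space M. \<exists>n. (f n y, y) \<in> r \<and> f n y \<in> reach k r i} \<in> sets M"
    by measurable
  then show ?case
    using Suc by simp
qed

lemma reach_space: "edge_set r \<Longrightarrow> reach k r i \<subseteq> space M"
  by (rule sets.sets_into_space[OF reach_sets])

lemma reach_mono: "i \<le> j \<Longrightarrow> reach k r i \<subseteq> reach k r j"
  by (rule lift_Suc_mono_le[of "reach k r"]) auto

lemma excess_integrable:
  assumes r: "edge_set r" shows "integrable M (\<lambda>x. real (card (r `` {x}) - k))"
proof (rule integrable_const_bound[of _ "real d"])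
  show "(\<lambda>x. real (card (r `` {x}) - k)) \<in> borel_measurable M"
    using card_section_measurable[OF r] by measurable
  have "card (r `` {x}) - k \<le> d" for x
    using edge_set_card_le[OF r, of x] by linarith
  then show "AE x in M. norm (real (card (r `` {x}) - k)) \<le> real d"
    by simp
qed

lemma excess_nonneg: "0 \<le> excess k r"
  unfolding excess_def by simp

lemma excess_le_overfull:
  assumes r: "edge_set r"
  shows "excess k r \<le> d * prob (overfull k r)"
proof -
  note [measurable] = overfull_sets[OF r]
  have "real (card (r `` {x}) - k) \<le> real d * indicator (overfull k r) x" if "x \<in> space M" for x
    using edge_set_card_le[OF r, of x] that by (auto simp: overfull_def indicator_def)
  then have "excess k r \<le> (\<integral>x. real d * indicator (overfull k r) x \<partial>M)"
    unfolding excess_def by (intro integral_mono excess_integrable r) (auto simp: emeasure_eq_measure)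
  then show ?thesis
    by simp
qed

text \<open>The mean outdegree \<open>d / 2\<close> is at most \<open>k\<close>, so the total excess
  is at most the total deficit, and the deficit of a vertex is at most \<open>k\<close> and vanishes
  unless the vertex is underfull.\<close>

lemma excess_le_underfull:
  assumes r: "strict_orientation r" and k: "d \<le> 2 * k"
  shows "excess k r \<le> k * prob (underfull k r)"
proof -
  have e: "edge_set r"
    by (rule strict_orientation_edge_set[OF r])
  note [measurable] = underfull_sets[OF e]
  have le: "real (card (r `` {x}) - k) \<le> real (card (r `` {x})) - k + real k * indicator (underfull k r) x"
    if "x \<in> space M" for x
    using that by (auto simp: underfull_def indicator_def)
  have "excess k r \<le> (\<integral>x. real (card (r `` {x})) - k + real k * indicator (underfull k r) x \<partial>M)"
    unfolding excess_def
    by (intro integral_mono excess_integrable[OF e] Bochner_Integration.integrable_add Bochner_Integration.integrable_diff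
        edge_set_integrable[OF e] le) (auto simp: emeasure_eq_measure)
  also have "\<dots> = measure edge_measure r - k + k * prob (underfull k r)"
    using edge_set_integrable[OF e]
    by (simp add: measure_edge_measure[OF e] prob_space emeasure_eq_measure)
  finally show ?thesis
    using k by (simp add: strict_orientation_measure[OF r])
qed

text \<open>The odds of \<open>reach k r i\<close> are multiplied by at least \<open>1 + l / (2 * d)\<close> in each step.\<close>

lemma excess_decay:
  assumes r: "strict_orientation r" and k: "d \<le> 2 * k" and l: "expanding l" and d: "0 < d"
    and null: "prob (reach k r n \<inter> underfull k r) = 0" and pos: "0 < excess k r"
  shows "(1 + l / (2 * d)) ^ n * (excess k r)\<^sup>2 \<le> k * d"
proof -
  have e: "edge_set r"
    by (rule strict_orientation_edge_set[OF r])
  note [measurable] = underfull_sets[OF e] reach_sets[OF e] overfull_sets[OF e]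
  define c where "c = l / (2 * d)"
  define a where "a i = prob (reach k r i)" for i
  have c: "0 < c"
    using l d by (simp add: c_def expanding_def)
  have kpos: "0 < k"
    using k d by linarith
  have am: "a i \<le> a j" if "i \<le> j" for i j
    unfolding a_def using reach_mono[OF that] by (intro finite_measure_mono) auto
  \<comment> \<open>Up to a null set the underfull vertices lie outside \<open>reach k r n\<close>,
    and their measure is at least the excess divided by \<open>k\<close>.\<close>
  have an: "excess k r / k \<le> 1 - a n"
  proof -
    have "prob (underfull k r) = prob (underfull k r - reach k r n \<inter> underfull k r)"
      using null by (subst finite_measure_Diff) auto
    also have "\<dots> \<le> prob (space M - reach k r n)"
      by (intro finite_measure_mono) (auto simp: underfull_def)
    also have "\<dots> = 1 - a n"
      by (simp add: a_def prob_compl)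
    finally have "k * prob (underfull k r) \<le> k * (1 - a n)"
      by (intro mult_left_mono) auto
    then have "excess k r \<le> k * (1 - a n)"
      using excess_le_underfull[OF r k] by linarith
    then show ?thesis
      using kpos by (simp add: field_simps)
  qed
  have a0: "excess k r / d \<le> a 0"
    using excess_le_overfull[OF e, of k] d by (simp add: a_def field_simps)
  have step: "a i + c * (a i * (1 - a i)) \<le> a (Suc i)" if "i < n" for i
    unfolding a_def c_def
  proof (rule out_neighbourhood_growth[OF r k l d])
    show "r `` reach k r i \<subseteq> reach k r (Suc i)"
    proof
      fix y assume "y \<in> r `` reach k r i"
      then obtain x where x: "x \<in> reach k r i" "(x, y) \<in> r" by auto
      then have "(x, y) \<in> G" using edge_set_subset[OF e] by auto
      then have "(y, x) \<in> G" by (rule G_symD)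
      with x show "y \<in> reach k r (Suc i)"
        by (auto simp: G_iff)
    qed
    have "prob (reach k r i \<inter> underfull k r) \<le> prob (reach k r n \<inter> underfull k r)"
      using reach_mono[of i n] that by (intro finite_measure_mono) auto
    then have "emeasure M (reach k r i \<inter> underfull k r) = 0"
      using null by (simp add: emeasure_eq_measure measure_le_0_iff)
    then have "AE x in M. x \<notin> reach k r i \<inter> underfull k r"
      by (intro AE_not_in) (auto simp: null_sets_def)
    then show "AE x in M. x \<in> reach k r i \<longrightarrow> k \<le> card (r `` {x})"
      using AE_space by eventually_elim (auto simp: underfull_def)
    show "reach k r i \<in> sets M" "reach k r (Suc i) \<in> sets M"
      by (rule reach_sets[OF e])+
    show "reach k r i \<subseteq> reach k r (Suc i)"
      by (rule reach_mono) simp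
  qed
  have bpos: "0 < 1 - a i" if "i \<le> n" for i
  proof -
    have "0 < excess k r / k" using pos kpos by simp
    then show ?thesis using an am[OF that] by linarith
  qed
  \<comment> \<open>This is growth of the odds \<open>a i / (1 - a i)\<close> with denominators
    cleared. In the induction step both sides are multiplied by \<open>?b\<close>, which is
    cancelled at the end.\<close>
  have odds: "(1 + c) ^ i * (a 0 * (1 - a i)) \<le> a i * (1 - a 0)" if "i \<le> n" for i
    using that
  proof (induction i)
    case (Suc i)
    let ?b = "1 - a i" and ?b' = "1 - a (Suc i)"
    have ai: "0 \<le> a i" by (simp add: a_def)
    have "(1 + c) * (a i * ?b') \<le> (1 + c) * (a i * (?b - c * (a i * ?b)))"
      using step[of i] Suc.prems ai c by (intro mult_left_mono) auto
    also have "\<dots> = (a i + c * (a i * ?b)) * ?b - c\<^sup>2 * (a i)\<^sup>2 * ?b"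
      by (simp add: algebra_simps power2_eq_square)
    also have "\<dots> \<le> (a i + c * (a i * ?b)) * ?b"
      using bpos[of i] Suc.prems by simp
    also have "\<dots> \<le> a (Suc i) * ?b"
      using step[of i] bpos[of i] Suc.prems by (intro mult_right_mono) auto
    finally have 1: "(1 + c) * (a i * ?b') \<le> a (Suc i) * ?b" .
    have "((1 + c) ^ Suc i * (a 0 * ?b')) * ?b = ((1 + c) ^ i * (a 0 * ?b)) * ((1 + c) * ?b')"
      by (simp add: algebra_simps)
    also have "\<dots> \<le> (a i * (1 - a 0)) * ((1 + c) * ?b')"
      using Suc bpos[of "Suc i"] c by (intro mult_right_mono) auto
    also have "\<dots> = ((1 + c) * (a i * ?b')) * (1 - a 0)"
      by (simp add: algebra_simps)
    also have "\<dots> \<le> (a (Suc i) * ?b) * (1 - a 0)"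
      using 1 bpos[of 0] by (intro mult_right_mono) auto
    finally have "((1 + c) ^ Suc i * (a 0 * ?b')) * ?b \<le> (a (Suc i) * (1 - a 0)) * ?b"
      by (simp add: algebra_simps)
    then show ?case
      using bpos[of i] Suc.prems by (meson Suc_leD mult_le_cancel_right_pos)
  qed simp
  \<comment> \<open>The excess enters twice, hence its square: overfull vertices bound
    \<open>a 0\<close> from below, and underfull ones bound \<open>1 - a n\<close> from
    below.\<close>
  have "(1 + c) ^ n * (excess k r / d * (excess k r / k)) \<le> (1 + c) ^ n * (a 0 * (1 - a n))"
    using a0 an pos c by (intro mult_left_mono mult_mono) (auto intro: order_trans[OF _ a0])
  also have "\<dots> \<le> a n * (1 - a 0)"
    by (rule odds) simp
  also have "\<dots> \<le> 1"
    by (rule mult_le_one) (auto simp: a_def)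
  finally show ?thesis
    using d kpos by (simp add: c_def field_simps power2_eq_square)
qed

text \<open>Each path starts at \<open>x\<close> in \<open>T\<close> and visits
  \<open>p 0 x, ..., p m x\<close>; \<open>q j\<close> recovers the start from the vertex at
  position \<open>j\<close>. When the disjoint paths are reversed, an inner vertex loses and gains
  one outgoing edge, a start loses one, and an end gains one but was below \<open>k\<close>
  before.\<close>

lemma flip_paths:
  assumes r: "strict_orientation r"
    and p [measurable]: "\<And>j. p j \<in> M \<rightarrow>\<^sub>M M" and q [measurable]: "\<And>j. q j \<in> M \<rightarrow>\<^sub>M M"
    and q_preserving: "\<And>j. distr M M (q j) = M"
    and qp: "\<And>j x. x \<in> space M \<Longrightarrow> q j (p j x) = x" and pq: "\<And>j x. x \<in> space M \<Longrightarrow> p j (q j x) = x"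
    and p0: "\<And>x. p 0 x = x"
    and T [measurable]: "T \<in> sets M"
    and edge: "\<And>x j. x \<in> T \<Longrightarrow> j < m \<Longrightarrow> (p j x, p (Suc j) x) \<in> r"
    and disj: "\<And>x y i j. x \<in> T \<Longrightarrow> y \<in> T \<Longrightarrow> i \<le> m \<Longrightarrow> j \<le> m \<Longrightarrow> p i x = p j y \<Longrightarrow> i = j \<and> x = y"
    and source: "\<And>x. x \<in> T \<Longrightarrow> x \<in> overfull k r"
    and sink: "\<And>x. x \<in> T \<Longrightarrow> p m x \<in> underfull k r"
  shows "\<exists>r'. strict_orientation r' \<and> excess k r' \<le> excess k r - prob T \<and>
    measure edge_measure ((r - r') \<union> (r' - r)) \<le> 2 * real m * prob T"
proof -
  have e: "edge_set r"
    by (rule strict_orientation_edge_set[OF r])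
  have Tsp: "x \<in> space M" if "x \<in> T" for x
    using that sets.sets_into_space[OF T] by auto
  \<comment> \<open>\<open>Q j\<close> collects the edges at position \<open>j\<close> of all paths.
    Expressing membership through \<open>q j\<close> avoids a quantifier over starting
    points.\<close>
  define Q where "Q j = {e \<in> space (M \<Otimes>\<^sub>M M). q j (fst e) \<in> T \<and> snd e = p (Suc j) (q j (fst e))}" for j
  define P where "P = (\<Union>j<m. Q j)"
  have Q_sets [measurable]: "Q j \<in> sets (M \<Otimes>\<^sub>M M)" for j
    unfolding Q_def by measurable
  have Q_iff: "(u, v) \<in> Q j \<longleftrightarrow> (\<exists>x\<in>T. u = p j x \<and> v = p (Suc j) x)" for u v j
  proof
    assume "(u, v) \<in> Q j"
    then show "\<exists>x\<in>T. u = p j x \<and> v = p (Suc j) x"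
      using pq[of u j] by (auto simp: Q_def space_pair_measure intro!: bexI[of _ "q j u"])
  next
    assume "\<exists>x\<in>T. u = p j x \<and> v = p (Suc j) x"
    then obtain x where "x \<in> T" "u = p j x" "v = p (Suc j) x" by auto
    then show "(u, v) \<in> Q j"
      using qp[of x j] Tsp[of x] measurable_space[OF p, of x j] measurable_space[OF p, of x "Suc j"]
      by (auto simp: Q_def space_pair_measure)
  qed
  have P_iff: "(u, v) \<in> P \<longleftrightarrow> (\<exists>x\<in>T. \<exists>j<m. u = p j x \<and> v = p (Suc j) x)" for u v
    by (auto simp: P_def Q_iff)
  have Pr: "P \<subseteq> r"
    using edge by (auto simp: P_iff)
  have P_sets [measurable]: "P \<in> sets (M \<Otimes>\<^sub>M M)"
    unfolding P_def by measurable
  have Pe: "edge_set P"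
    using Pr e P_sets by (auto simp: edge_set_def)
  have Pc [measurable]: "P\<inverse> \<in> sets (M \<Otimes>\<^sub>M M)"
    by (rule converse_sets) simp
  note [measurable] = edge_set_sets[OF e]
  define r' where "r' = (r - P) \<union> P\<inverse>"
  have rG: "r \<union> r\<inverse> = G" "r \<inter> r\<inverse> = {}"
    using r by (auto simp: strict_orientation_def)
  have r': "strict_orientation r'"
    unfolding strict_orientation_def
  proof (intro conjI)
    show "r' \<in> sets (M \<Otimes>\<^sub>M M)"
      unfolding r'_def by measurable
    show "r' \<union> r'\<inverse> = G"
      using rG Pr by (auto simp: r'_def)
    show "r' \<inter> r'\<inverse> = {}"
      using rG Pr by (auto simp: r'_def)
  qed
  have card': "card (r' `` {u}) = card (r `` {u}) - card (P `` {u}) + card (P\<inverse> `` {u})"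
    and card_le: "card (P `` {u}) \<le> card (r `` {u})" for u
  proof -
    have "r' `` {u} = (r `` {u} - P `` {u}) \<union> P\<inverse> `` {u}"
      by (auto simp: r'_def)
    moreover have "(r `` {u} - P `` {u}) \<inter> P\<inverse> `` {u} = {}"
      using rG Pr by auto
    moreover have sub: "P `` {u} \<subseteq> r `` {u}"
      using Pr by auto
    moreover note edge_set_finite[OF e, of u] edge_set_finite[OF Pe, of u]
      edge_set_finite[OF edge_set_converse[OF Pe], of u]
    ultimately show "card (r' `` {u}) = card (r `` {u}) - card (P `` {u}) + card (P\<inverse> `` {u})"
      by (simp add: card_Un_disjoint card_Diff_subset)
    show "card (P `` {u}) \<le> card (r `` {u})"
      using sub edge_set_finite[OF e] by (intro card_mono)
  qed
  \<comment> \<open>By disjointness a vertex on a path determines both the path and its position, so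
    it has at most one path edge in each direction. The cases below are start, inner vertex, end,
    and vertex off all paths.\<close>
  have drop: "real (card (r' `` {u}) - k) \<le> real (card (r `` {u}) - k) - indicator T u" for u
  proof (cases "\<exists>x\<in>T. \<exists>i\<le>m. u = p i x")
    case True
    then obtain x i where x: "x \<in> T" and i: "i \<le> m" and u: "u = p i x"
      by auto
    have out: "P `` {u} = (if i < m then {p (Suc i) x} else {})"
    proof (intro set_eqI iffI)
      fix v assume "v \<in> P `` {u}"
      then obtain y j where y: "y \<in> T" "j < m" "u = p j y" "v = p (Suc j) y"
        by (auto simp: P_iff)
      then have "i = j \<and> x = y"
        using disj[of x y i j] x i u by auto
      then show "v \<in> (if i < m then {p (Suc i) x} else {})"
        using y by auto
    qed (use x u in \<open>auto simp: P_iff split: if_splits\<close>)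
    have inn: "P\<inverse> `` {u} = (if 0 < i then {p (i - 1) x} else {})"
    proof (intro set_eqI iffI)
      fix v assume "v \<in> P\<inverse> `` {u}"
      then obtain y j where y: "y \<in> T" "j < m" "v = p j y" "u = p (Suc j) y"
        by (auto simp: P_iff)
      then have "i = Suc j \<and> x = y"
        using disj[of x y i "Suc j"] x i u by auto
      then show "v \<in> (if 0 < i then {p (i - 1) x} else {})"
        using y by auto
    next
      fix v assume "v \<in> (if 0 < i then {p (i - 1) x} else {})"
      then obtain j where "i = Suc j" "v = p j x"
        by (cases i) auto
      then show "v \<in> P\<inverse> `` {u}"
        using x u i by (auto simp: P_iff intro!: bexI[of _ x] exI[of _ j])
    qed
    show ?thesis
    proof (cases "i = 0")
      case True
      then have ux: "u = x"
        using u p0 by simp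
      \<comment> \<open>A path of length 0 would make its vertex both overfull and
        underfull.\<close>
      have "m \<noteq> 0"
      proof
        assume "m = 0"
        then show False
          using source[OF x] sink[OF x] p0 by (auto simp: overfull_def underfull_def)
      qed
      then have "card (r' `` {u}) = card (r `` {u}) - 1"
        using True by (simp add: card' out inn)
      then show ?thesis
        using source[OF x] x ux by (auto simp: overfull_def)
    next
      case False
      have uT: "u \<notin> T"
        using disj[of u x 0 i] x i u p0 False by auto
      show ?thesis
      proof (cases "i < m")
        case True
        then show ?thesis
          using uT False card_le[of u] by (simp add: card' out inn)
      next
        case False
        then have "i = m"
          using i by simp
        \<comment> \<open>The end has room for one more outgoing edge, so its truncated excess stays
          0.\<close>
        then have "card (r `` {u}) < k"
          using sink[OF x] u by (simp add: underfull_def)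
        then show ?thesis
          using uT False \<open>i \<noteq> 0\<close> by (simp add: card' out inn)
      qed
    qed
  next
    case False
    then have "P `` {u} = {}" "P\<inverse> `` {u} = {}" "u \<notin> T"
      using p0 by (auto simp: P_iff) (metis less_imp_le_nat Suc_leI le0)+
    then show ?thesis
      by (simp add: card')
  qed
  have int: "integrable M (indicator T :: 'a \<Rightarrow> real)"
    by (simp add: emeasure_eq_measure)
  have "excess k r' \<le> (\<integral>u. real (card (r `` {u}) - k) - indicator T u \<partial>M)"
    unfolding excess_def
    by (intro integral_mono excess_integrable strict_orientation_edge_set r' e
        Bochner_Integration.integrable_diff int drop)
  also have "\<dots> = excess k r - prob T"
    using excess_integrable[OF e] int by (simp add: excess_def)
  finally have ex: "excess k r' \<le> excess k r - prob T" .
  \<comment> \<open>At most one edge of \<open>Q j\<close> starts at a given vertex, and only at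
    vertices in the preimage of \<open>T\<close> under the measure preserving map
    \<open>q j\<close>.\<close>
  have NQ: "measure edge_measure (Q j) \<le> prob T" if "j < m" for j
  proof -
    let ?B = "q j -` T \<inter> space M"
    have B: "?B \<in> sets M"
      by measurable
    have Qe: "edge_set (Q j)"
      using Pe that by (auto simp: edge_set_def P_def)
    have "measure edge_measure (Q j) = measure edge_measure (Q j \<inter> ?B \<times> space M)"
      by (rule arg_cong[where f = "measure edge_measure"]) (auto simp: Q_def space_pair_measure)
    also have "\<dots> \<le> 1 * prob ?B"
    proof (rule section_restrict_le[OF Qe B], rule AE_I2, rule impI)
      fix u
      have "Q j `` {u} \<subseteq> {p (Suc j) (q j u)}"
        by (auto simp: Q_def)
      then have "card (Q j `` {u}) \<le> card {p (Suc j) (q j u)}"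
        by (intro card_mono) auto
      then show "real (card (Q j `` {u})) \<le> 1"
        by simp
    qed
    also have "prob ?B = measure (distr M M (q j)) T"
      by (rule measure_distr[symmetric]) measurable
    finally show ?thesis
      by (simp add: q_preserving)
  qed
  have "measure edge_measure P \<le> (\<Sum>j<m. measure edge_measure (Q j))"
    unfolding P_def by (intro measure_UNION_le) auto
  also have "\<dots> \<le> (\<Sum>j<m. prob T)"
    by (intro sum_mono NQ) simp
  finally have NP: "measure edge_measure P \<le> m * prob T"
    by simp
  have "measure edge_measure ((r - r') \<union> (r' - r)) \<le> measure edge_measure (P \<union> P\<inverse>)"
    by (rule N.finite_measure_mono) (auto simp: r'_def)
  also have "\<dots> \<le> measure edge_measure P + measure edge_measure (P\<inverse>)"
    by (rule measure_Un_le) auto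
  finally have "measure edge_measure ((r - r') \<union> (r' - r)) \<le> 2 * real m * prob T"
    using NP edge_measure_converse[OF Pe] by simp
  with r' ex show ?thesis
    by (intro exI[of _ r'] conjI)
qed

text \<open>The fixed points of \<open>h\<close> in \<open>A\<close> form a set of the desired kind,
  and so do, for each \<open>s\<close>, the points of \<open>A\<close> in \<open>U s\<close> whose
  image lies outside \<open>U s\<close>. These countably many sets cover \<open>A\<close>, so one of
  them has positive measure.\<close>

lemma positive_measure_displaced:
  assumes [measurable]: "h \<in> M \<rightarrow>\<^sub>M M" "A \<in> sets M" and pos: "0 < prob A"
  shows "\<exists>T\<in>sets M. T \<subseteq> A \<and> 0 < prob T \<and> (\<forall>x\<in>T. h x \<in> T \<longrightarrow> h x = x)"
proof (rule ccontr)
  assume contra: "\<not> ?thesis"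
  have null: "T \<in> null_sets M" if "T \<in> sets M" "T \<subseteq> A" "\<forall>x\<in>T. h x \<in> T \<longrightarrow> h x = x" for T
    using contra that by (auto simp: null_sets_def emeasure_eq_measure not_less measure_le_0_iff)
  let ?F = "{x \<in> A. h x = x}" and ?D = "\<lambda>s. {x \<in> A. x \<in> U s \<and> h x \<notin> U s}"
  have sub: "A \<subseteq> space M"
    by (rule sets.sets_into_space) simp
  have F: "?F \<in> null_sets M"
  proof (rule null)
    have "?F = {x \<in> space M. x \<in> A \<and> h x = x}"
      using sub by auto
    then show "?F \<in> sets M" by simp
  qed auto
  have D: "?D s \<in> null_sets M" for s
  proof (rule null)
    have "?D s = {x \<in> space M. x \<in> A \<and> x \<in> U s \<and> h x \<notin> U s}"
      using sub by auto
    then show "?D s \<in> sets M" by simp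
  qed auto
  have "?F \<union> (\<Union>s. ?D s) \<in> null_sets M"
    using F D by (intro null_sets.Un null_sets_UN) auto
  moreover have "A \<subseteq> ?F \<union> (\<Union>s. ?D s)"
  proof
    fix x assume x: "x \<in> A"
    then have "x \<in> space M" "h x \<in> space M"
      using sub measurable_space[OF assms(1)] by auto
    then show "x \<in> ?F \<union> (\<Union>s. ?D s)"
      using U_separating[of x "h x"] x by (cases "h x = x") auto
  qed
  ultimately have "A \<in> null_sets M"
    using null_sets_subset[of _ M A] by simp
  then show False
    using pos by (simp add: null_sets_def emeasure_eq_measure)
qed

text \<open>The property passes to subsets, so the maps can be treated one after the other.\<close>

lemma positive_measure_displaced_finite:
  assumes "finite H" "\<And>h. h \<in> H \<Longrightarrow> h \<in> M \<rightarrow>\<^sub>M M" "A \<in> sets M" "0 < prob A"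
  shows "\<exists>T\<in>sets M. T \<subseteq> A \<and> 0 < prob T \<and> (\<forall>h\<in>H. \<forall>x\<in>T. h x \<in> T \<longrightarrow> h x = x)"
  using assms
proof (induction H rule: finite_induct)
  case (insert h H)
  then obtain T where T: "T \<in> sets M" "T \<subseteq> A" "0 < prob T" "\<forall>h\<in>H. \<forall>x\<in>T. h x \<in> T \<longrightarrow> h x = x"
    by auto
  obtain S where "S \<in> sets M" "S \<subseteq> T" "0 < prob S" "\<forall>x\<in>S. h x \<in> S \<longrightarrow> h x = x"
    using positive_measure_displaced[of h T] insert.prems T by auto
  with T show ?case
    by (intro bexI[of _ S]) auto
qed auto

section \<open>Paths coded by finite words in the involutions\<close>

lemma fold_f_measurable [measurable]: "fold f w \<in> M \<rightarrow>\<^sub>M M"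
proof (induction w)
  case Nil
  then show ?case by (simp add: id_def)
next
  case (Cons i w)
  then show ?case by (auto intro: measurable_comp[OF f_measurable])
qed

lemma fold_f_space: "x \<in> space M \<Longrightarrow> fold f w x \<in> space M"
  by (rule measurable_space[OF fold_f_measurable])

lemma fold_f_rev: "x \<in> space M \<Longrightarrow> fold f (rev w) (fold f w x) = x"
  by (induction w arbitrary: x) (auto simp: f_involution)

lemma fold_f_preserving: "distr M M (fold f w) = M"
proof (induction w)
  case Nil
  then show ?case by (simp add: id_def)
next
  case (Cons i w)
  have "distr M M (fold f (i # w)) = distr (distr M M (f i)) M (fold f w)"
    by (simp add: distr_distr)
  then show ?case
    by (simp add: f_preserving Cons comp_def)
qed

text \<open>Trace a vertex back from the first step at which it is reached. The vertex at position
  \<open>j\<close> is then first reached at step exactly \<open>j\<close>, which makes all vertices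
  of the path distinct.\<close>

lemma reach_path:
  assumes e: "edge_set r" and y: "y \<in> reach k r i" "\<And>l. l < i \<Longrightarrow> y \<notin> reach k r l"
  shows "\<exists>w x. length w = i \<and> x \<in> space M \<and> fold f w x = y \<and>
    (\<forall>j\<le>i. fold f (take j w) x \<in> reach k r j \<and> (\<forall>l<j. fold f (take j w) x \<notin> reach k r l)) \<and>
    (\<forall>j<i. (fold f (take j w) x, fold f (take (Suc j) w) x) \<in> r)"
  using y
proof (induction i arbitrary: y)
  case 0
  then show ?case
    using reach_space[OF e, of k 0] by (intro exI[of _ "[]"] exI[of _ y]) auto
next
  case (Suc i)
  then obtain n where y: "y \<in> space M" and n: "(f n y, y) \<in> r" "f n y \<in> reach k r i"
    by force
  \<comment> \<open>If the predecessor had been reached earlier, \<open>y\<close> would have been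
    too.\<close>
  have "f n y \<notin> reach k r l" if "l < i" for l
  proof
    assume "f n y \<in> reach k r l"
    then have "y \<in> reach k r (Suc l)"
      using n y by auto
    then show False
      using Suc.prems(2)[of "Suc l"] that by auto
  qed
  from Suc.IH[OF n(2) this] obtain w x where w: "length w = i" "x \<in> space M" "fold f w x = f n y"
    and 1: "\<And>j. j \<le> i \<Longrightarrow> fold f (take j w) x \<in> reach k r j \<and> (\<forall>l<j. fold f (take j w) x \<notin> reach k r l)"
    and 2: "\<And>j. j < i \<Longrightarrow> (fold f (take j w) x, fold f (take (Suc j) w) x) \<in> r"
    by auto
  let ?w = "w @ [n]"
  have end_eq: "fold f ?w x = y"
    using w y by (simp add: f_involution)
  have t: "take j ?w = take j w" if "j \<le> i" for j
    using that w by simp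
  have t': "take (Suc i) ?w = ?w"
    using w by simp
  show ?case
  proof (intro exI[of _ ?w] exI[of _ x] conjI allI impI)
    fix j assume "j \<le> Suc i"
    then consider "j \<le> i" | "j = Suc i" by linarith
    then show "fold f (take j ?w) x \<in> reach k r j" "\<And>l. l < j \<Longrightarrow> fold f (take j ?w) x \<notin> reach k r l"
      by (cases; use 1[of j] t[of j] t' end_eq Suc.prems in auto)+
  next
    fix j assume "j < Suc i"
    then consider "j < i" | "j = i" by linarith
    then show "(fold f (take j ?w) x, fold f (take (Suc j) ?w) x) \<in> r"
    proof cases
      case 1
      then show ?thesis using 2[of j] t[of j] t[of "Suc j"] by auto
    next
      case 2
      then show ?thesis using t[of i] t' end_eq w n by auto
    qed
  qed (use w end_eq in auto)
qed

text \<open>There are only countably many words, so one word \<open>w\<close> describes augmenting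
  paths from a set of starting points of positive measure. Thinning this set makes the paths
  disjoint, and \<open>flip_paths\<close> applies.\<close>

lemma augment:
  assumes r: "strict_orientation r" and pos: "0 < prob (reach k r n \<inter> underfull k r)"
  shows "\<exists>r' t. strict_orientation r' \<and> 0 < t \<and> excess k r' \<le> excess k r - t \<and>
    measure edge_measure ((r - r') \<union> (r' - r)) \<le> 2 * real n * t"
proof -
  have e: "edge_set r"
    by (rule strict_orientation_edge_set[OF r])
  note [measurable] = overfull_sets[OF e] underfull_sets[OF e] reach_sets[OF e] edge_set_sets[OF e]
  \<comment> \<open>The last clause asks that the path be simple; without it one path could meet
    itself.\<close>
  define path where "path w x \<longleftrightarrow> x \<in> overfull k r \<and> fold f w x \<in> underfull k r \<and>
    (\<forall>j<length w. (fold f (take j w) x, fold f (take (Suc j) w) x) \<in> r) \<and>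
    (\<forall>i\<le>length w. \<forall>j\<le>length w. i \<noteq> j \<longrightarrow> fold f (take i w) x \<noteq> fold f (take j w) x)" for w x
  define A where "A w = {x \<in> space M. path w x}" for w
  have A [measurable]: "A w \<in> sets M" for w
    unfolding A_def path_def by measurable
  have "\<exists>w. length w \<le> n \<and> 0 < prob (A w)"
  proof (rule ccontr)
    assume contra: "\<not> ?thesis"
    let ?W = "{w. length w \<le> n}"
    \<comment> \<open>\<open>?E w\<close> is the set of endpoints of the paths with word
      \<open>w\<close>. It has the measure of \<open>A w\<close>, and these sets cover all reached
      underfull vertices.\<close>
    let ?E = "\<lambda>w. fold f (rev w) -` A w \<inter> space M"
    have "?E w \<in> null_sets M" if "w \<in> ?W" for w
    proof -
      have "emeasure M (?E w) = emeasure (distr M M (fold f (rev w))) (A w)"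
        by (rule emeasure_distr[symmetric]) measurable
      also have "\<dots> = 0"
        using contra that
        by (auto simp: fold_f_preserving emeasure_eq_measure not_less measure_le_0_iff)
      finally show ?thesis
        by (auto simp: null_sets_def)
    qed
    then have "(\<Union>w\<in>?W. ?E w) \<in> null_sets M"
      by (intro null_sets_UN') auto
    moreover have "reach k r n \<inter> underfull k r \<subseteq> (\<Union>w\<in>?W. ?E w)"
    proof
      fix y assume y: "y \<in> reach k r n \<inter> underfull k r"
      define i where "i = (LEAST i. y \<in> reach k r i)"
      have i: "y \<in> reach k r i"
        unfolding i_def using y by (intro LeastI[of "\<lambda>i. y \<in> reach k r i" n]) auto
      have less: "y \<notin> reach k r l" if "l < i" for l
        using not_less_Least[of l "\<lambda>i. y \<in> reach k r i"] that by (simp add: i_def)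
      have "i \<le> n"
        unfolding i_def using y by (intro Least_le) auto
      obtain w x where w: "length w = i" "x \<in> space M" "fold f w x = y"
        and 1: "\<forall>j\<le>i. fold f (take j w) x \<in> reach k r j \<and> (\<forall>l<j. fold f (take j w) x \<notin> reach k r l)"
        and 2: "\<forall>j<i. (fold f (take j w) x, fold f (take (Suc j) w) x) \<in> r"
        using reach_path[OF e i less] by blast
      have "x \<in> overfull k r"
        using 1[rule_format, of 0] by simp
      moreover have "fold f (take a w) x \<noteq> fold f (take b w) x" if "a \<le> i" "b \<le> i" "a \<noteq> b" for a b
        using 1[rule_format, of a] 1[rule_format, of b] that by (metis nat_neq_iff)
      ultimately have "x \<in> A w"
        using w 2 y by (simp add: A_def path_def)
      then have "y \<in> ?E w"
        using w fold_f_rev[of x w] fold_f_space[of x w] by auto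
      then show "y \<in> (\<Union>w\<in>?W. ?E w)"
        using w \<open>i \<le> n\<close> by auto
    qed
    ultimately have "reach k r n \<inter> underfull k r \<in> null_sets M"
      using null_sets_subset[of _ M "reach k r n \<inter> underfull k r"] by simp
    then show False
      using pos by (simp add: null_sets_def emeasure_eq_measure)
  qed
  then obtain w where w: "length w \<le> n" "0 < prob (A w)"
    by auto
  let ?m = "length w"
  define p where "p j = fold f (take j w)" for j
  define q where "q j = fold f (rev (take j w))" for j
  have pm [measurable]: "p j \<in> M \<rightarrow>\<^sub>M M" and qm [measurable]: "q j \<in> M \<rightarrow>\<^sub>M M" for j
    by (simp_all add: p_def q_def)
  have qp: "q j (p j x) = x" and pq: "p j (q j x) = x" if "x \<in> space M" for x j
    using fold_f_rev[OF that, of "take j w"] fold_f_rev[OF that, of "rev (take j w)"]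
    by (simp_all add: p_def q_def)
  \<comment> \<open>If the paths from \<open>x\<close> and \<open>y\<close> meet in
    \<open>p i x = p j y\<close>, then \<open>y = q j (p i x)\<close>. So it is enough that no map
    in \<open>H\<close> takes a point of \<open>T\<close> to another point of
    \<open>T\<close>.\<close>
  define H where "H = (\<lambda>(i, j) x. q j (p i x)) ` ({..?m} \<times> {..?m})"
  have "\<exists>T\<in>sets M. T \<subseteq> A w \<and> 0 < prob T \<and> (\<forall>h\<in>H. \<forall>x\<in>T. h x \<in> T \<longrightarrow> h x = x)"
    by (rule positive_measure_displaced_finite) (use w in \<open>auto simp: H_def\<close>)
  then obtain T where T: "T \<in> sets M" "T \<subseteq> A w" "0 < prob T"
    and TH: "\<And>i j x. i \<le> ?m \<Longrightarrow> j \<le> ?m \<Longrightarrow> x \<in> T \<Longrightarrow> q j (p i x) \<in> T \<Longrightarrow> q j (p i x) = x"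
    by (fastforce simp: H_def)
  have Tsp: "x \<in> space M" and Tpath: "path w x" if "x \<in> T" for x
    using that T(2) by (auto simp: A_def)
  have "\<exists>r'. strict_orientation r' \<and> excess k r' \<le> excess k r - prob T \<and>
    measure edge_measure ((r - r') \<union> (r' - r)) \<le> 2 * real ?m * prob T"
  proof (rule flip_paths[OF r, of p q])
    show "distr M M (q j) = M" for j
      by (simp add: q_def fold_f_preserving)
    show "p 0 x = x" for x
      by (simp add: p_def)
    fix x assume x: "x \<in> T"
    show "(p j x, p (Suc j) x) \<in> r" if "j < ?m" for j
      using Tpath[OF x] that by (simp add: path_def p_def)
    show "x \<in> overfull k r" "p ?m x \<in> underfull k r"
      using Tpath[OF x] by (simp_all add: path_def p_def)
    fix y i j assume y: "y \<in> T" and ij: "i \<le> ?m" "j \<le> ?m" and eq: "p i x = p j y"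
    have "q j (p i x) = y"
      using eq qp[OF Tsp[OF y]] by simp
    then have xy: "x = y"
      using TH[OF ij x] y by simp
    then have "i = j"
      using Tpath[OF x] ij eq by (auto simp: path_def p_def)
    with xy show "i = j \<and> x = y"
      by simp
  qed (use T qp pq in auto)
  then obtain r' where r': "strict_orientation r'" "excess k r' \<le> excess k r - prob T"
    "measure edge_measure ((r - r') \<union> (r' - r)) \<le> 2 * real ?m * prob T"
    by auto
  have "2 * real ?m * prob T \<le> 2 * real n * prob T"
    using w by (intro mult_right_mono) auto
  from order_trans[OF r'(3) this] show ?thesis
    using r' T(3) by (intro exI[of _ r'] exI[of _ "prob T"] conjI)
qed

section \<open>Complete space of orientations\<close>

text \<open>Direct each edge by the first \<open>U s\<close> that separates its ends, from the end
  inside to the end outside; this is the lexicographic order of the sequences of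
  memberships.\<close>

lemma exists_strict_orientation: "\<exists>r. strict_orientation r"
proof -
  define D where "D s x y \<longleftrightarrow> x \<in> U s \<and> y \<notin> U s \<and> (\<forall>t<s. x \<in> U t \<longleftrightarrow> y \<in> U t)" for s x y
  define r where "r = G \<inter> {p \<in> space (M \<Otimes>\<^sub>M M). \<exists>s. D s (fst p) (snd p)}"
  have "r \<in> sets (M \<Otimes>\<^sub>M M)"
    unfolding r_def D_def by measurable
  moreover have iff: "(x, y) \<in> r \<longleftrightarrow> (x, y) \<in> G \<and> (\<exists>s. D s x y)" for x y
    using G_subset by (auto simp: r_def space_pair_measure)
  have total: "(\<exists>s. D s x y) \<or> (\<exists>s. D s y x)" if xy: "(x, y) \<in> G" for x y
  proof -
    have "x \<in> space M" "y \<in> space M" "x \<noteq> y"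
      using xy G_subset by (auto simp: G_iff)
    then obtain s0 where s0: "(x \<in> U s0) \<noteq> (y \<in> U s0)"
      using U_separating by blast
    define s where "s = (LEAST s. (x \<in> U s) \<noteq> (y \<in> U s))"
    have "(x \<in> U s) \<noteq> (y \<in> U s)"
      unfolding s_def by (rule LeastI[of "\<lambda>s. (x \<in> U s) \<noteq> (y \<in> U s)", OF s0])
    moreover have "(x \<in> U t) = (y \<in> U t)" if "t < s" for t
      using not_less_Least[of t "\<lambda>s. (x \<in> U s) \<noteq> (y \<in> U s)"] that by (simp add: s_def)
    ultimately have "D s x y \<or> D s y x"
      unfolding D_def by auto
    then show ?thesis by auto
  qed
  have antisym: "\<not> (D s x y \<and> D t y x)" for s t x y
    unfolding D_def by (cases s t rule: linorder_cases) auto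
  have "(x, y) \<in> r \<union> r\<inverse> \<longleftrightarrow> (x, y) \<in> G" for x y
    using total[of x y] by (auto simp: iff dest: G_symD)
  then have "r \<union> r\<inverse> = G"
    by auto
  moreover have "r \<inter> r\<inverse> = {}"
    using antisym by (auto simp: iff)
  ultimately show ?thesis
    unfolding strict_orientation_def by blast
qed

section \<open>Distance, continuity of the excess and limits\<close>

definition flip_dist :: "('a \<times> 'a) set \<Rightarrow> ('a \<times> 'a) set \<Rightarrow> real" where
  "flip_dist r s = measure edge_measure ((r - s) \<union> (s - r))"

lemma flip_dist_triangle:
  assumes "edge_set r" "edge_set s" "edge_set t"
  shows "flip_dist r t \<le> flip_dist r s + flip_dist s t"
proof -
  note [measurable] = assms[THEN edge_set_sets]
  have "flip_dist r t \<le> measure edge_measure (((r - s) \<union> (s - r)) \<union> ((s - t) \<union> (t - s)))"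
    unfolding flip_dist_def by (rule N.finite_measure_mono) auto
  also have "\<dots> \<le> flip_dist r s + flip_dist s t"
    unfolding flip_dist_def by (rule measure_Un_le) auto
  finally show ?thesis .
qed

lemma excess_lipschitz:
  assumes r: "edge_set r" and s: "edge_set s"
  shows "excess k r \<le> excess k s + flip_dist r s"
proof -
  let ?S = "(r - s) \<union> (s - r)"
  note [measurable] = edge_set_sets[OF r] edge_set_sets[OF s]
  have S: "edge_set ?S"
    using r s by (intro edge_set_Un edge_set_Diff) auto
  have le: "real (card (r `` {x}) - k) \<le> real (card (s `` {x}) - k) + real (card (?S `` {x}))" for x
  proof -
    have "card (r `` {x}) \<le> card (s `` {x} \<union> ?S `` {x})"
      using edge_set_finite[OF s] edge_set_finite[OF S] by (intro card_mono) auto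
    also have "\<dots> \<le> card (s `` {x}) + card (?S `` {x})"
      by (rule card_Un_le)
    finally show ?thesis by linarith
  qed
  have "excess k r \<le> (\<integral>x. real (card (s `` {x}) - k) + real (card (?S `` {x})) \<partial>M)"
    unfolding excess_def
    by (intro integral_mono excess_integrable r s Bochner_Integration.integrable_add edge_set_integrable S le)
  then show ?thesis
    using excess_integrable[OF s] edge_set_integrable[OF S]
    by (simp add: excess_def flip_dist_def measure_edge_measure[OF S])
qed

text \<open>An edge whose direction never changes after stage \<open>n\<close> has that direction in
  the limit. So \<open>s n\<close> and the limit differ only on edges that change at some later
  step, and the measures of these changes telescope to at most \<open>F n - L\<close>.\<close>

lemma flip_dist_complete:
  assumes s: "\<And>n. strict_orientation (s n)"
    and le: "\<And>n. flip_dist (s n) (s (Suc n)) \<le> F n - F (Suc n)" and L: "F \<longlonglongrightarrow> L"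
  shows "\<exists>r. strict_orientation r \<and> (\<forall>n. flip_dist (s n) r \<le> F n - L)"
proof -
  have e: "edge_set (s n)" for n
    by (rule strict_orientation_edge_set[OF s])
  note [measurable] = edge_set_sets[OF e]
  define In where "In p \<longleftrightarrow> (\<exists>m. \<forall>n\<ge>m. p \<in> s n)" for p
  define Out where "Out p \<longleftrightarrow> (\<exists>m. \<forall>n\<ge>m. p \<notin> s n)" for p
  \<comment> \<open>Edges that change direction infinitely often fall back on \<open>s 0\<close>, so
    that the limit is a strict orientation everywhere and not just almost everywhere.\<close>
  define r where "r = {p \<in> space (M \<Otimes>\<^sub>M M). p \<in> G \<and> (In p \<or> (\<not> In p \<and> \<not> Out p \<and> p \<in> s 0))}"
  have r_iff: "p \<in> r \<longleftrightarrow> p \<in> G \<and> (In p \<or> (\<not> In p \<and> \<not> Out p \<and> p \<in> s 0))" for p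
    using sets.sets_into_space[OF G_sets] by (auto simp: r_def)
  have r_sets [measurable]: "r \<in> sets (M \<Otimes>\<^sub>M M)"
    unfolding r_def In_def Out_def by measurable
  have flip: "(y, x) \<in> s n \<longleftrightarrow> (x, y) \<notin> s n" if "(x, y) \<in> G" for x y n
    using s[of n] that by (auto simp: strict_orientation_def)
  \<comment> \<open>Reversing an edge exchanges \<open>In\<close> and \<open>Out\<close>, so the
    rule defining \<open>r\<close> picks exactly one direction of each edge.\<close>
  have swap: "In (y, x) = Out (x, y)" "Out (y, x) = In (x, y)" if "(x, y) \<in> G" for x y
    using flip[OF that] by (simp_all add: In_def Out_def)
  have InOut: "\<not> (In p \<and> Out p)" for p
    unfolding In_def Out_def by (meson nle_le)
  have opp: "(y, x) \<in> r \<longleftrightarrow> (x, y) \<notin> r" if xy: "(x, y) \<in> G" for x y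
    using InOut[of "(x, y)"] flip[OF xy, of 0] swap[OF xy] G_symD[OF xy] xy by (auto simp: r_iff)
  have sub: "r \<subseteq> G"
    by (auto simp: r_iff)
  have r: "strict_orientation r"
    unfolding strict_orientation_def
  proof (intro conjI)
    show "r \<union> r\<inverse> = G"
      using opp sub by (auto dest: G_symD)
    show "r \<inter> r\<inverse> = {}"
      using opp sub by auto
  qed simp
  have "flip_dist (s n) r \<le> F n - L" for n
  proof -
    let ?D = "\<lambda>i. (s (n + i) - s (Suc (n + i))) \<union> (s (Suc (n + i)) - s (n + i))"
    have "(\<lambda>i. F (n + i)) \<longlonglongrightarrow> L"
      using LIMSEQ_ignore_initial_segment[OF L, of n] by (simp add: add.commute)
    from telescope_sums'[OF this]
    have F: "(\<lambda>i. F (n + i) - F (Suc (n + i))) sums (F n - L)"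
      by simp
    have D: "measure edge_measure (?D i) \<le> F (n + i) - F (Suc (n + i))" for i
      using le[of "n + i"] by (simp add: flip_dist_def)
    have summ: "summable (\<lambda>i. measure edge_measure (?D i))"
      by (rule summable_comparison_test'[OF sums_summable[OF F], of 0]) (use D in simp)
    have "(s n - r) \<union> (r - s n) \<subseteq> (\<Union>i. ?D i)"
    proof (rule ccontr)
      assume "\<not> ?thesis"
      then obtain p where p: "p \<in> (s n - r) \<union> (r - s n)" and const: "\<And>i. p \<in> s (n + i) \<longleftrightarrow> p \<in> s (Suc (n + i))"
        by blast
      have "p \<in> s (n + i) \<longleftrightarrow> p \<in> s n" for i
        by (induction i) (use const in auto)
      then have *: "p \<in> s m \<longleftrightarrow> p \<in> s n" if "n \<le> m" for m
        using le_Suc_ex[OF that] by auto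
      show False
      proof (cases "p \<in> s n")
        case True
        then have "In p"
          using * unfolding In_def by blast
        then show False
          using True p edge_set_subset[OF e[of n]] by (auto simp: r_iff)
      next
        case False
        then have "Out p"
          using * unfolding Out_def by blast
        then show False
          using False p InOut[of p] by (auto simp: r_iff)
      qed
    qed
    then have "flip_dist (s n) r \<le> measure edge_measure (\<Union>i. ?D i)"
      unfolding flip_dist_def by (intro N.finite_measure_mono) auto
    also have "\<dots> \<le> (\<Sum>i. measure edge_measure (?D i))"
      by (rule N.finite_measure_subadditive_countably) (use summ in auto)
    also have "\<dots> \<le> (\<Sum>i. F (n + i) - F (Suc (n + i)))"
      by (intro suminf_le D summ sums_summable[OF F])
    also have "\<dots> = F n - L"
      using F by (simp add: sums_iff)
    finally show ?thesis .
  qed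
  with r show ?thesis
    by blast
qed

text \<open>By \<open>excess_decay\<close> the choice of \<open>n\<close> forces an underfull vertex
  within reach, so \<open>augment\<close> applies. The square root is what makes the cost telescope:
  the gain \<open>t\<close> is at most \<open>2 * ?a * (?a - ?b)\<close>, and the path length is
  absorbed by \<open>n * ?a \<le> K\<close>.\<close>

lemma improve_orientation:
  assumes r: "strict_orientation r" and k: "d \<le> 2 * k" and l: "expanding l"
    and pos: "0 < excess k r" and n: "k * d < (1 + l / (2 * d)) ^ n * (excess k r)\<^sup>2"
    and K: "n * sqrt (excess k r) \<le> K"
  shows "\<exists>r'. strict_orientation r' \<and> sqrt (excess k r') < sqrt (excess k r) \<and>
    flip_dist r r' \<le> 4 * K * (sqrt (excess k r) - sqrt (excess k r'))"
proof -
  have e: "edge_set r"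
    by (rule strict_orientation_edge_set[OF r])
  have d: "0 < d"
  proof (rule ccontr)
    assume "\<not> 0 < d"
    then have "excess k r \<le> 0"
      using excess_le_overfull[OF e, of k] by simp
    with pos show False by simp
  qed
  have "prob (reach k r n \<inter> underfull k r) \<noteq> 0"
    using excess_decay[OF r k l d _ pos, of n] n by linarith
  then have "0 < prob (reach k r n \<inter> underfull k r)"
    by (simp add: zero_less_measure_iff)
  from augment[OF r this] obtain r' t where r': "strict_orientation r'" and t: "0 < t"
    and ex: "excess k r' \<le> excess k r - t" and dist: "flip_dist r r' \<le> 2 * real n * t"
    unfolding flip_dist_def by blast
  let ?a = "sqrt (excess k r)" and ?b = "sqrt (excess k r')"
  have ab: "0 \<le> ?b" "?b < ?a"
    using ex t excess_nonneg by auto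
  have "t \<le> excess k r - excess k r'"
    using ex by simp
  also have "\<dots> = ?a\<^sup>2 - ?b\<^sup>2"
    using excess_nonneg by simp
  also have "\<dots> = (?a + ?b) * (?a - ?b)"
    by (simp add: power2_eq_square algebra_simps)
  also have "\<dots> \<le> (2 * ?a) * (?a - ?b)"
    using ab by (intro mult_right_mono) auto
  finally have "2 * real n * t \<le> 2 * real n * ((2 * ?a) * (?a - ?b))"
    by (intro mult_left_mono) auto
  also have "\<dots> = 4 * (n * ?a) * (?a - ?b)"
    by simp
  also have "\<dots> \<le> 4 * K * (?a - ?b)"
    using K ab by (intro mult_right_mono mult_left_mono) auto
  finally have "flip_dist r r' \<le> 4 * K * (?a - ?b)"
    using dist by (rule order_trans[rotated])
  with r' ab(2) show ?thesis
    by (intro exI[of _ r'] conjI)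
qed

lemma exists_balanced_orientation:
  assumes k: "d \<le> 2 * k" and l: "expanding l"
  shows "\<exists>r. strict_orientation r \<and> excess k r = 0"
proof -
  obtain r0 where r0: "strict_orientation r0"
    using exists_strict_orientation by blast
  show ?thesis
  \<comment> \<open>For \<open>d = 0\<close> the quotient \<open>l / (2 * d)\<close> takes the
    default value 0 and gives no growth, but then the excess vanishes anyway.\<close>
  proof (cases "d = 0")
    case True
    have "excess k r0 \<le> 0"
      using excess_le_overfull[OF strict_orientation_edge_set[OF r0], of k] True by simp
    then show ?thesis
      using r0 excess_nonneg[of k r0] by (intro exI[of _ r0]) auto
  next
    case False
    then have "0 < l / (2 * d)"
      using l by (simp add: expanding_def)
    from logarithmic_exponent_bound[OF this, of "k * d"] obtain K where K: "0 < K"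
      and bound: "\<And>x. 0 < x \<Longrightarrow> \<exists>n::nat. k * d < (1 + l / (2 * d)) ^ n * x\<^sup>2 \<and> n * sqrt x \<le> K"
      by auto
    define F where "F r = 4 * K * sqrt (excess k r)" for r
    \<comment> \<open>The Caristi order: a move is allowed if the drop of the potential
      \<open>F\<close> pays for the distance. The factor \<open>4 * K\<close> in \<open>F\<close> is
      the cost bound of \<open>improve_orientation\<close>.\<close>
    define R where "R r r' \<longleftrightarrow> strict_orientation r \<and> strict_orientation r' \<and> flip_dist r r' \<le> F r - F r'" for r r'
    have dist0: "0 \<le> flip_dist r r'" for r r'
      by (simp add: flip_dist_def)
    have "\<exists>b. R r0 b \<and> (\<forall>c. R b c \<longrightarrow> F c = F b)"
    proof (rule order_principle)
      show "0 \<le> F r" for r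
        using K excess_nonneg by (simp add: F_def)
      show "R r0 r0"
        using r0 by (simp add: R_def flip_dist_def)
      show "R y y" if "R x y" for x y
        using that by (simp add: R_def flip_dist_def)
      show "F y \<le> F x" if "R x y" for x y
        using that dist0[of x y] by (auto simp: R_def)
      show "R x z" if "R x y" "R y z" for x y z
      proof -
        have "flip_dist x z \<le> flip_dist x y + flip_dist y z"
          using that by (intro flip_dist_triangle strict_orientation_edge_set) (auto simp: R_def)
        then show ?thesis
          using that by (auto simp: R_def)
      qed
      fix s :: "nat \<Rightarrow> ('a \<times> 'a) set" assume "\<And>n. R (s n) (s (Suc n))"
      then have s: "\<And>n. strict_orientation (s n)"
        and le: "\<And>n. flip_dist (s n) (s (Suc n)) \<le> F (s n) - F (s (Suc n))"
        by (auto simp: R_def)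
      have dec: "decseq (\<lambda>n. F (s n))"
        using le dist0 by (intro decseq_SucI) (smt (verit))
      have "0 \<le> F (s n)" for n
        using K excess_nonneg by (simp add: F_def)
      then obtain L where L: "(\<lambda>n. F (s n)) \<longlonglongrightarrow> L"
        using decseq_convergent[OF dec, of 0] by blast
      obtain r where r: "strict_orientation r" and rs: "\<And>n. flip_dist (s n) r \<le> F (s n) - L"
        using flip_dist_complete[OF s le L] by auto
      have edges: "edge_set r" "edge_set (s n)" for n
        using r s strict_orientation_edge_set by auto
      have "(\<lambda>n. F (s n) - L) \<longlonglongrightarrow> 0"
        using tendsto_diff[OF L tendsto_const[of L]] by simp
      moreover have "\<bar>excess k (s n) - excess k r\<bar> \<le> F (s n) - L" for n
      proof -
        have "flip_dist r (s n) = flip_dist (s n) r"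
          by (simp add: flip_dist_def Un_commute)
        then show ?thesis
          using excess_lipschitz[OF edges(1) edges(2), of k n] excess_lipschitz[OF edges(2) edges(1), of k n] rs[of n]
          by linarith
      qed
      ultimately have "(\<lambda>n. excess k (s n) - excess k r) \<longlonglongrightarrow> 0"
        using Lim_null_comparison[of "\<lambda>n. excess k (s n) - excess k r" "\<lambda>n. F (s n) - L" sequentially]
        by simp
      then have "(\<lambda>n. excess k (s n)) \<longlonglongrightarrow> excess k r"
        by (rule LIM_zero_cancel)
      \<comment> \<open>Continuity of the excess identifies the limit of the potentials with
        \<open>F r\<close>, so the bound by \<open>F (s n) - L\<close> says that \<open>r\<close>
        lies above the whole chain.\<close>
      then have "(\<lambda>n. F (s n)) \<longlonglongrightarrow> F r"
        unfolding F_def by (intro tendsto_intros)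
      then have "L = F r"
        using L LIMSEQ_unique by blast
      then have "R (s n) r" for n
        using r s[of n] rs[of n] by (simp add: R_def)
      then show "\<exists>b. \<forall>n. R (s n) b"
        by blast
    qed
    then obtain r where r: "strict_orientation r" and min: "\<And>c. R r c \<Longrightarrow> F c = F r"
      by (auto simp: R_def)
    have "excess k r = 0"
    proof (rule ccontr)
      assume "excess k r \<noteq> 0"
      then have pos: "0 < excess k r"
        using excess_nonneg[of k r] by simp
      obtain n :: nat where "k * d < (1 + l / (2 * d)) ^ n * (excess k r)\<^sup>2" "n * sqrt (excess k r) \<le> K"
        using bound[OF pos] by auto
      from improve_orientation[OF r k l pos this]
      obtain r' where r': "strict_orientation r'" "sqrt (excess k r') < sqrt (excess k r)"
        "flip_dist r r' \<le> 4 * K * (sqrt (excess k r) - sqrt (excess k r'))"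
        by auto
      then have "R r r'"
        using r by (simp add: R_def F_def algebra_simps)
      then have "F r' = F r" by (rule min)
      then show False
        using r' K by (simp add: F_def)
    qed
    with r show ?thesis by blast
  qed
qed

section \<open>The orientation number\<close>

lemma expansive_imp_expanding:
  assumes "expansive M G"
  shows "\<exists>l. expanding l"
proof -
  \<comment> \<open>The infimum is infinite if no set of measure in the admissible range exists. Any
    positive constant then serves, whereas \<open>enn2real\<close> would give 0.\<close>
  define l where "l = (if expansion_constant M G = \<top> then 1 else enn2real (expansion_constant M G))"
  have l: "0 < l" "ennreal l \<le> expansion_constant M G"
    using assms by (auto simp: l_def expansive_def enn2real_positive_iff less_top)
  have "l * prob A \<le> measure edge_measure (G \<inter> A \<times> (space M - A))"
    if A [measurable]: "A \<in> sets M" and half: "prob A \<le> 1 / 2" for A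
  proof (cases "prob A = 0")
    case False
    then have pos: "0 < prob A"
      by (simp add: zero_less_measure_iff)
    let ?E = "G \<inter> A \<times> (space M - A)"
    have E: "edge_set ?E"
      by (rule edge_set_Int[OF edge_set_G]) simp
    have "ennreal (1 / 2) = 1 / 2"
      by (subst divide_ennreal[symmetric]) simp_all
    moreover have "emeasure M A \<le> ennreal (1 / 2)"
      unfolding emeasure_eq_measure by (rule ennreal_leI[OF half])
    ultimately have half': "emeasure M A \<le> 1 / 2"
      by metis
    have "ennreal_of_enat (ecard (G `` {x} - A)) * indicator A x = ennreal (real (card (?E `` {x})))"
      if x: "x \<in> space M" for x
    proof (cases "x \<in> A")
      case True
      have "?E `` {x} = G `` {x} - A"
        using True G_subset by auto
      then show ?thesis
        using True G_finite[OF x] by (simp add: ecard_def ennreal_of_nat_eq_real_of_nat)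
    next
      case False
      then have "?E `` {x} = {}" by auto
      with False show ?thesis by simp
    qed
    then have int: "(\<integral>\<^sup>+x\<in>A. ennreal_of_enat (ecard (G `` {x} - A)) \<partial>M) = emeasure edge_measure ?E"
      unfolding emeasure_edge_measure[OF E] by (intro nn_integral_cong) simp
    have "ennreal l \<le> (\<integral>\<^sup>+x\<in>A. ennreal_of_enat (ecard (G `` {x} - A)) \<partial>M) / emeasure M A"
      using l(2) unfolding expansion_constant_def
      by (rule order_trans) (intro INF_lower, use half' pos in \<open>auto simp: emeasure_eq_measure\<close>)
    also have "\<dots> = ennreal (measure edge_measure ?E / prob A)"
      using pos by (simp add: int N.emeasure_eq_measure emeasure_eq_measure divide_ennreal)
    finally have "l \<le> measure edge_measure ?E / prob A"
      using pos by (subst (asm) ennreal_le_iff) auto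
    then show ?thesis
      using pos by (simp add: field_simps)
  qed simp
  then show ?thesis
    using l(1) unfolding expanding_def by blast
qed

lemma orientation_number_le:
  assumes k: "d \<le> 2 * k" and l: "expanding l"
  shows "orientation_number M G \<le> enat k"
proof -
  obtain r where r: "strict_orientation r" and ex: "excess k r = 0"
    using exists_balanced_orientation[OF k l] by auto
  have e: "edge_set r"
    by (rule strict_orientation_edge_set[OF r])
  note [measurable] = edge_set_sets[OF e] overfull_sets[OF e]
  have A [measurable]: "space M - overfull k r \<in> sets M"
    by simp
  \<comment> \<open>Zero excess still permits a null set of overfull vertices, which is removed;
    restricting \<open>r\<close> to the rest can only lower outdegrees.\<close>
  let ?A = "space M - overfull k r"
  let ?r = "r \<inter> ?A \<times> ?A"
  have "AE x in M. real (card (r `` {x}) - k) = 0"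
    using ex integral_nonneg_eq_0_iff_AE[OF excess_integrable[OF e, of k]] by (simp add: excess_def)
  then have "AE x in M. x \<notin> overfull k r"
    by eventually_elim (auto simp: overfull_def)
  then have "emeasure M (overfull k r) = 0"
    using AE_iff_measurable[OF overfull_sets[OF e, of k], of "\<lambda>x. x \<notin> overfull k r"]
    by (auto simp: overfull_def)
  moreover have "space M - ?A = overfull k r"
    by (auto simp: overfull_def)
  ultimately have null: "emeasure M (space M - ?A) = 0"
    by simp
  have ori: "orientation (G \<inter> ?A \<times> ?A) ?r"
    using r by (auto simp: orientation_def strict_orientation_def)
  have "outdegree ?r x \<le> enat k" if "x \<in> ?A" for x
  proof -
    have "card (?r `` {x}) \<le> card (r `` {x})"
      using edge_set_finite[OF e] by (intro card_mono) auto
    moreover have "finite (?r `` {x})"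
      by (rule finite_subset[OF _ edge_set_finite[OF e, of x]]) auto
    ultimately show ?thesis
      using that by (auto simp: outdegree_def ecard_def overfull_def)
  qed
  then have "(SUP x\<in>?A. outdegree ?r x) \<le> enat k"
    by (rule SUP_least)
  moreover have "(SUP x\<in>?A. outdegree ?r x) \<in> orientation_values M G"
    unfolding orientation_values_def
    by (intro CollectI exI[of _ ?A] exI[of _ ?r] conjI refl A null ori) measurable
  ultimately show ?thesis
    unfolding orientation_number_def by (meson Inf_lower order_trans)
qed

lemma orientation_number_ge:
  assumes k: "\<And>s. d \<le> 2 * s \<Longrightarrow> k \<le> s"
  shows "enat k \<le> orientation_number M G"
  unfolding orientation_number_def
proof (rule Inf_greatest)
  fix v assume "v \<in> orientation_values M G"
  then obtain A r where v: "v = (SUP x\<in>A. outdegree r x)" and A: "A \<in> sets M"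
    "emeasure M (space M - A) = 0" and r: "r \<in> sets (M \<Otimes>\<^sub>M M)" "orientation (G \<inter> A \<times> A) r"
    by (auto simp: orientation_values_def)
  show "enat k \<le> v"
  proof (cases v)
    case (enat s)
    have "card (r `` {x}) \<le> s" if "x \<in> A" for x
    proof -
      have "outdegree r x \<le> enat s"
        unfolding enat[symmetric] v using that by (rule SUP_upper)
      then show ?thesis
        by (auto simp: outdegree_def ecard_def split: if_splits)
    qed
    then have "d \<le> 2 * s"
      by (rule orientation_outdegree_ge[OF r(1) A r(2)])
    then show ?thesis
      using k enat by simp
  qed simp
qed

end

theorem mainTheorem6:
  fixes M :: "'a measure" and G :: "('a \<times> 'a) set" and d :: nat
  assumes "standard_borel M"
    and "prob_space M"
    and "borel_graph M G"
    and "locally_countable (space M) G"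
    and "regular (space M) G d"
    and "invariant_measure M G"
    and "expansive M G"
  shows "orientation_number M G = enat (nat \<lceil>real d / 2\<rceil>)"
proof -
  interpret prob_space M by fact
  obtain U :: "nat \<Rightarrow> 'a set" where U: "\<And>s. U s \<in> sets M"
    "\<And>x y. x \<in> space M \<Longrightarrow> y \<in> space M \<Longrightarrow> x \<noteq> y \<Longrightarrow> \<exists>s. x \<in> U s \<and> y \<notin> U s"
    using standard_borel_separating[OF assms(1) not_empty] by metis
  obtain f :: "nat \<Rightarrow> 'a \<Rightarrow> 'a" where f: "\<And>n. mp_involution M (f n)"
    "G = (\<Union>n. involution_graph (space M) (f n))"
    using assms(6) by (auto simp: invariant_measure_def)
  interpret mp_regular_graph M G d f U
  proof
    show "f n \<in> M \<rightarrow>\<^sub>M M" "distr M M (f n) = M" for n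
      using f(1)[of n] by (auto simp: mp_involution_def)
    show "f n (f n x) = x" if "x \<in> space M" for n x
      using f(1)[of n] that by (auto simp: mp_involution_def)
    show "G \<in> sets (M \<Otimes>\<^sub>M M)"
      using assms(3) by (simp add: borel_graph_def)
    show "finite (G `` {x})" "card (G `` {x}) = d" if "x \<in> space M" for x
      using assms(5) that by (auto simp: regular_def ecard_eq_enat_iff)
  qed (use U f(2) in auto)
  obtain l where l: "expanding l"
    using expansive_imp_expanding[OF assms(7)] by auto
  show ?thesis
  proof (rule antisym)
    show "orientation_number M G \<le> enat (nat \<lceil>real d / 2\<rceil>)"
      by (rule orientation_number_le[OF _ l]) linarith
    show "enat (nat \<lceil>real d / 2\<rceil>) \<le> orientation_number M G"
      by (rule orientation_number_ge) linarith
  qed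
qed

end
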